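(* Let $A$ be a right-symmetric algebra with universal enveloping algebra $U(A)$, and let $\Delta:U(A)\to U(A)\otimes U(A)$ be the homomorphism of unital algebras determined by $$\Delta(1)=1\otimes 1,\qquad \Delta(r_a)=r_a\otimes 1+1\otimes(r_a-l_a),\qquad \Delta(l_a)=l_a\otimes 1\qquad(a\in A).$$ Then $\Delta$ is coassociative: $(1\otimes\Delta)\circ\Delta=(\Delta\otimes 1)\circ\Delta$ as maps $U(A)\to U(A)\otimes U(A)\otimes U(A)$.
   Context: A right-symmetric algebra over a field $\mathcal K$ is a $\mathcal K$-vector space $A$ with a bilinear product $\circ$ satisfying $(a\circ b)\circ c-a\circ(b\circ c)=(a\circ c)\circ b-a\circ(c\circ b)$ for all $a,b,c\in A$. Put $[a,b]=a\circ b-b\circ a$. Let $A^r=\{r_a:a\in A\}$ and $A^l=\{l_a:a\in A\}$ be two copies of the vector space $A$ (so $a\mapsto r_a$ and $a\mapsto l_a$ are linear). The universal enveloping algebra $U(A)$ is the quotient of the unital associative tensor algebra $T(A^r\oplus A^l)$ by the two-sided ideal generated by all elements $r_{[a,b]}-r_ar_b+r_br_a$ and $[r_b,l_a]-l_bl_a+l_{a\circ b}$, $a,b\in A$, where $[r_b,l_a]=r_bl_a-l_ar_b$. The images of $r_a,l_a$ in $U(A)$ are denoted by the same letters. The map $\Delta$ is well defined on $U(A)$. Here $1\otimes\Delta$ and $\Delta\otimes 1$ use the identity map on the other factor. *)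

theory Defs
  imports "HOL-Algebra.Module" "HOL-Algebra.QuotRing"
begin

section \<open>Right-symmetric algebras\<close>

text \<open>
  The product of the algebra is the field \<open>mult\<close> of the record \<open>A\<close>; it is neither associative
  nor unital, and the field \<open>one\<close> of \<open>A\<close> plays no role.  (The locale \<open>module\<close> constrains only
  the additive structure and the scalar multiplication.)
\<close>

locale right_symmetric_algebra = K?: field K + A?: module K A
  for K :: "('k, 'n) ring_scheme" (structure) and A :: "('k, 'a, 'm) module_scheme" (structure) +
  assumes prod_closed:
      "\<lbrakk>a \<in> carrier A; b \<in> carrier A\<rbrakk> \<Longrightarrow> a \<otimes>\<^bsub>A\<^esub> b \<in> carrier A"
    and prod_add_left:
      "\<lbrakk>a \<in> carrier A; b \<in> carrier A; c \<in> carrier A\<rbrakk>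
        \<Longrightarrow> (a \<oplus>\<^bsub>A\<^esub> b) \<otimes>\<^bsub>A\<^esub> c = a \<otimes>\<^bsub>A\<^esub> c \<oplus>\<^bsub>A\<^esub> b \<otimes>\<^bsub>A\<^esub> c"
    and prod_add_right:
      "\<lbrakk>a \<in> carrier A; b \<in> carrier A; c \<in> carrier A\<rbrakk>
        \<Longrightarrow> a \<otimes>\<^bsub>A\<^esub> (b \<oplus>\<^bsub>A\<^esub> c) = a \<otimes>\<^bsub>A\<^esub> b \<oplus>\<^bsub>A\<^esub> a \<otimes>\<^bsub>A\<^esub> c"
    and prod_smult_left:
      "\<lbrakk>k \<in> carrier K; a \<in> carrier A; b \<in> carrier A\<rbrakk>
        \<Longrightarrow> (k \<odot>\<^bsub>A\<^esub> a) \<otimes>\<^bsub>A\<^esub> b = k \<odot>\<^bsub>A\<^esub> (a \<otimes>\<^bsub>A\<^esub> b)"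
    and prod_smult_right:
      "\<lbrakk>k \<in> carrier K; a \<in> carrier A; b \<in> carrier A\<rbrakk>
        \<Longrightarrow> a \<otimes>\<^bsub>A\<^esub> (k \<odot>\<^bsub>A\<^esub> b) = k \<odot>\<^bsub>A\<^esub> (a \<otimes>\<^bsub>A\<^esub> b)"
    and right_symmetric:
      "\<lbrakk>a \<in> carrier A; b \<in> carrier A; c \<in> carrier A\<rbrakk>
        \<Longrightarrow> (a \<otimes>\<^bsub>A\<^esub> b) \<otimes>\<^bsub>A\<^esub> c \<ominus>\<^bsub>A\<^esub> a \<otimes>\<^bsub>A\<^esub> (b \<otimes>\<^bsub>A\<^esub> c)
          = (a \<otimes>\<^bsub>A\<^esub> c) \<otimes>\<^bsub>A\<^esub> b \<ominus>\<^bsub>A\<^esub> a \<otimes>\<^bsub>A\<^esub> (c \<otimes>\<^bsub>A\<^esub> b)"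

definition commutator :: "('a, 'm) ring_scheme \<Rightarrow> 'a \<Rightarrow> 'a \<Rightarrow> 'a" where
  "commutator R x y = x \<otimes>\<^bsub>R\<^esub> y \<ominus>\<^bsub>R\<^esub> y \<otimes>\<^bsub>R\<^esub> x"


section \<open>Unital associative algebras over a ring\<close>

text \<open>
  Unital algebras are \<open>module\<close> records as well; the locale \<open>algebra\<close> of the library is not used
  because it requires the product to be commutative.
\<close>

definition unital_algebra_hom ::
  "('k, 'n) ring_scheme \<Rightarrow> ('k, 'b, 'm) module_scheme \<Rightarrow> ('k, 'c, 'p) module_scheme
    \<Rightarrow> ('b \<Rightarrow> 'c) set" where
  "unital_algebra_hom K B C =
    {h \<in> ring_hom B C. \<forall>k\<in>carrier K. \<forall>x\<in>carrier B. h (k \<odot>\<^bsub>B\<^esub> x) = k \<odot>\<^bsub>C\<^esub> h x}"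

text \<open>
  The quotient by \<open>N\<close>, with the scalar multiplication \<open>k (N + x) = N + k x\<close>.  For a subspace
  \<open>N\<close> that is not an ideal only the vector space structure of the result is meaningful.
\<close>

definition quotient_algebra ::
  "('k, 'b, 'm) module_scheme \<Rightarrow> 'b set \<Rightarrow> ('k, 'b set) module" where
  "quotient_algebra B N =
    \<lparr>carrier = carrier (B Quot N), mult = mult (B Quot N), one = one (B Quot N),
     zero = zero (B Quot N), add = add (B Quot N),
     smult = (\<lambda>k X. \<Union>x\<in>X. N +>\<^bsub>B\<^esub> (k \<odot>\<^bsub>B\<^esub> x))\<rparr>"

definition submodule_span ::
  "('k, 'n) ring_scheme \<Rightarrow> ('k, 'b, 'm) module_scheme \<Rightarrow> 'b set \<Rightarrow> 'b set" where
  "submodule_span K M S = \<Inter>{N. submodule N K M \<and> S \<subseteq> N}"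

text \<open>
  The monoid algebra \<open>K[M]\<close>: finitely supported functions on \<open>M\<close> with convolution.  Its
  underlying vector space is the free vector space on the set \<open>carrier M\<close>, with basis
  \<open>monomial K w\<close> for \<open>w \<in> carrier M\<close>.
\<close>

definition monoid_algebra ::
  "('k, 'n) ring_scheme \<Rightarrow> ('w, 'p) monoid_scheme \<Rightarrow> ('k, 'w \<Rightarrow> 'k) module" where
  "monoid_algebra K M =
    \<lparr>carrier = {f. (\<forall>w. f w \<in> carrier K) \<and> finite {w. f w \<noteq> \<zero>\<^bsub>K\<^esub>}
                  \<and> {w. f w \<noteq> \<zero>\<^bsub>K\<^esub>} \<subseteq> carrier M},
     mult = (\<lambda>f g w. \<Oplus>\<^bsub>K\<^esub>p\<in>{(u, v). f u \<noteq> \<zero>\<^bsub>K\<^esub> \<and> g v \<noteq> \<zero>\<^bsub>K\<^esub> \<and> u \<otimes>\<^bsub>M\<^esub> v = w}.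
                          f (fst p) \<otimes>\<^bsub>K\<^esub> g (snd p)),
     one = (\<lambda>w. if w = \<one>\<^bsub>M\<^esub> then \<one>\<^bsub>K\<^esub> else \<zero>\<^bsub>K\<^esub>),
     zero = (\<lambda>w. \<zero>\<^bsub>K\<^esub>),
     add = (\<lambda>f g w. f w \<oplus>\<^bsub>K\<^esub> g w),
     smult = (\<lambda>k f w. k \<otimes>\<^bsub>K\<^esub> f w)\<rparr>"

definition monomial :: "('k, 'n) ring_scheme \<Rightarrow> 'w \<Rightarrow> 'w \<Rightarrow> 'k" where
  "monomial K w = (\<lambda>v. if v = w then \<one>\<^bsub>K\<^esub> else \<zero>\<^bsub>K\<^esub>)"


section \<open>The tensor algebra of a vector space\<close>

definition word_monoid :: "'v set \<Rightarrow> 'v list monoid" where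
  "word_monoid S = \<lparr>carrier = lists S, mult = (@), one = []\<rparr>"

text \<open>
  The tensor algebra \<open>T(V)\<close> is the free associative algebra on the set \<open>V\<close> modulo the ideal
  making \<open>V \<rightarrow> T(V)\<close> linear.  In degree \<open>n\<close> this is the free vector space on \<open>n\<close>-tuples of
  vectors modulo multilinearity, that is, the \<open>n\<close>-th tensor power of \<open>V\<close>; the class of the
  word \<open>[v\<^sub>1, \<dots>, v\<^sub>n]\<close> is the product of \<open>v\<^sub>1, \<dots>, v\<^sub>n\<close>.
\<close>

definition tensor_algebra_ideal ::
  "('k, 'n) ring_scheme \<Rightarrow> ('k, 'v, 'm) module_scheme \<Rightarrow> ('v list \<Rightarrow> 'k) set" where
  "tensor_algebra_ideal K V =
    (let F = monoid_algebra K (word_monoid (carrier V)) in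
      Idl\<^bsub>F\<^esub>
        ({monomial K [u \<oplus>\<^bsub>V\<^esub> v] \<ominus>\<^bsub>F\<^esub> monomial K [u] \<ominus>\<^bsub>F\<^esub> monomial K [v] | u v.
            u \<in> carrier V \<and> v \<in> carrier V}
         \<union> {monomial K [k \<odot>\<^bsub>V\<^esub> v] \<ominus>\<^bsub>F\<^esub> k \<odot>\<^bsub>F\<^esub> monomial K [v] | k v.
            k \<in> carrier K \<and> v \<in> carrier V}))"

definition tensor_algebra ::
  "('k, 'n) ring_scheme \<Rightarrow> ('k, 'v, 'm) module_scheme \<Rightarrow> ('k, ('v list \<Rightarrow> 'k) set) module" where
  "tensor_algebra K V =
    quotient_algebra (monoid_algebra K (word_monoid (carrier V))) (tensor_algebra_ideal K V)"

definition tensor_algebra_inj ::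
  "('k, 'n) ring_scheme \<Rightarrow> ('k, 'v, 'm) module_scheme \<Rightarrow> 'v \<Rightarrow> ('v list \<Rightarrow> 'k) set" where
  "tensor_algebra_inj K V v =
    tensor_algebra_ideal K V +>\<^bsub>monoid_algebra K (word_monoid (carrier V))\<^esub> monomial K [v]"


section \<open>The universal enveloping algebra\<close>

text \<open>Only the vector space structure matters here, so \<open>mult\<close> and \<open>one\<close> are left unspecified.\<close>

definition direct_sum ::
  "('k, 'b, 'm) module_scheme \<Rightarrow> ('k, 'c, 'p) module_scheme \<Rightarrow> ('k, 'b \<times> 'c) module" where
  "direct_sum V W =
    \<lparr>carrier = carrier V \<times> carrier W, mult = undefined, one = undefined,
     zero = (\<zero>\<^bsub>V\<^esub>, \<zero>\<^bsub>W\<^esub>),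
     add = (\<lambda>(v, w) (v', w'). (v \<oplus>\<^bsub>V\<^esub> v', w \<oplus>\<^bsub>W\<^esub> w')),
     smult = (\<lambda>k (v, w). (k \<odot>\<^bsub>V\<^esub> v, k \<odot>\<^bsub>W\<^esub> w))\<rparr>"

text \<open>
  \<open>A\<^sup>r \<oplus> A\<^sup>l\<close> is \<open>direct_sum A A\<close>, where \<open>r\<^sub>a = (a, 0)\<close> and \<open>l\<^sub>a = (0, a)\<close>; the next two
  functions give the images of these vectors in the tensor algebra.
\<close>

definition tensor_r ::
  "('k, 'n) ring_scheme \<Rightarrow> ('k, 'a, 'm) module_scheme \<Rightarrow> 'a \<Rightarrow> (('a \<times> 'a) list \<Rightarrow> 'k) set" where
  "tensor_r K A a = tensor_algebra_inj K (direct_sum A A) (a, \<zero>\<^bsub>A\<^esub>)"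

definition tensor_l ::
  "('k, 'n) ring_scheme \<Rightarrow> ('k, 'a, 'm) module_scheme \<Rightarrow> 'a \<Rightarrow> (('a \<times> 'a) list \<Rightarrow> 'k) set" where
  "tensor_l K A a = tensor_algebra_inj K (direct_sum A A) (\<zero>\<^bsub>A\<^esub>, a)"

definition enveloping_ideal ::
  "('k, 'n) ring_scheme \<Rightarrow> ('k, 'a, 'm) module_scheme \<Rightarrow> (('a \<times> 'a) list \<Rightarrow> 'k) set set" where
  "enveloping_ideal K A =
    (let T = tensor_algebra K (direct_sum A A); r = tensor_r K A; l = tensor_l K A in
      Idl\<^bsub>T\<^esub>
        ({r (commutator A a b) \<ominus>\<^bsub>T\<^esub> r a \<otimes>\<^bsub>T\<^esub> r b \<oplus>\<^bsub>T\<^esub> r b \<otimes>\<^bsub>T\<^esub> r a | a b.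
            a \<in> carrier A \<and> b \<in> carrier A}
         \<union> {commutator T (r b) (l a) \<ominus>\<^bsub>T\<^esub> l b \<otimes>\<^bsub>T\<^esub> l a \<oplus>\<^bsub>T\<^esub> l (a \<otimes>\<^bsub>A\<^esub> b) | a b.
            a \<in> carrier A \<and> b \<in> carrier A}))"

definition enveloping_algebra ::
  "('k, 'n) ring_scheme \<Rightarrow> ('k, 'a, 'm) module_scheme
    \<Rightarrow> ('k, (('a \<times> 'a) list \<Rightarrow> 'k) set set) module" where
  "enveloping_algebra K A =
    quotient_algebra (tensor_algebra K (direct_sum A A)) (enveloping_ideal K A)"

definition env_r ::
  "('k, 'n) ring_scheme \<Rightarrow> ('k, 'a, 'm) module_scheme
    \<Rightarrow> 'a \<Rightarrow> (('a \<times> 'a) list \<Rightarrow> 'k) set set" where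
  "env_r K A a = enveloping_ideal K A +>\<^bsub>tensor_algebra K (direct_sum A A)\<^esub> tensor_r K A a"

definition env_l ::
  "('k, 'n) ring_scheme \<Rightarrow> ('k, 'a, 'm) module_scheme
    \<Rightarrow> 'a \<Rightarrow> (('a \<times> 'a) list \<Rightarrow> 'k) set set" where
  "env_l K A a = enveloping_ideal K A +>\<^bsub>tensor_algebra K (direct_sum A A)\<^esub> tensor_l K A a"


section \<open>Tensor products of algebras\<close>

text \<open>
  The free vector space on \<open>B \<times> C\<close> modulo the subspace of bilinearity relations.  Taking the
  free vector space with the convolution product of the multiplicative monoid \<open>B \<times> C\<close> makes the
  product of the quotient the usual one, \<open>(b \<otimes> c) (b' \<otimes> c') = b b' \<otimes> c c'\<close>, with unit
  \<open>1 \<otimes> 1\<close>: the subspace is an ideal, since multiplying a relation by a basis vector gives a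
  relation of the same kind.
\<close>

definition tensor_relations ::
  "('k, 'n) ring_scheme \<Rightarrow> ('k, 'b, 'm) module_scheme \<Rightarrow> ('k, 'c, 'p) module_scheme
    \<Rightarrow> ('b \<times> 'c \<Rightarrow> 'k) set" where
  "tensor_relations K B C =
    (let F = monoid_algebra K (B \<times>\<times> C); e = monomial K in
      submodule_span K F
        ({e (b \<oplus>\<^bsub>B\<^esub> b', c) \<ominus>\<^bsub>F\<^esub> e (b, c) \<ominus>\<^bsub>F\<^esub> e (b', c) | b b' c.
            b \<in> carrier B \<and> b' \<in> carrier B \<and> c \<in> carrier C}
         \<union> {e (b, c \<oplus>\<^bsub>C\<^esub> c') \<ominus>\<^bsub>F\<^esub> e (b, c) \<ominus>\<^bsub>F\<^esub> e (b, c') | b c c'.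
            b \<in> carrier B \<and> c \<in> carrier C \<and> c' \<in> carrier C}
         \<union> {e (k \<odot>\<^bsub>B\<^esub> b, c) \<ominus>\<^bsub>F\<^esub> k \<odot>\<^bsub>F\<^esub> e (b, c) | k b c.
            k \<in> carrier K \<and> b \<in> carrier B \<and> c \<in> carrier C}
         \<union> {e (b, k \<odot>\<^bsub>C\<^esub> c) \<ominus>\<^bsub>F\<^esub> k \<odot>\<^bsub>F\<^esub> e (b, c) | k b c.
            k \<in> carrier K \<and> b \<in> carrier B \<and> c \<in> carrier C}))"

definition tensor_product ::
  "('k, 'n) ring_scheme \<Rightarrow> ('k, 'b, 'm) module_scheme \<Rightarrow> ('k, 'c, 'p) module_scheme
    \<Rightarrow> ('k, ('b \<times> 'c \<Rightarrow> 'k) set) module" where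
  "tensor_product K B C =
    quotient_algebra (monoid_algebra K (B \<times>\<times> C)) (tensor_relations K B C)"

definition pure_tensor ::
  "('k, 'n) ring_scheme \<Rightarrow> ('k, 'b, 'm) module_scheme \<Rightarrow> ('k, 'c, 'p) module_scheme
    \<Rightarrow> 'b \<Rightarrow> 'c \<Rightarrow> ('b \<times> 'c \<Rightarrow> 'k) set" where
  "pure_tensor K B C b c =
    tensor_relations K B C +>\<^bsub>monoid_algebra K (B \<times>\<times> C)\<^esub> monomial K (b, c)"

text \<open>
  The linear map \<open>b \<otimes> c \<mapsto> \<beta> b c\<close> into \<open>Z\<close> induced by a bilinear map \<open>\<beta>\<close>.  A class is sent to
  the value of the linear extension of \<open>\<beta>\<close> on any of its representatives \<open>f\<close>; bilinearity of
  \<open>\<beta>\<close> makes the image of the class a singleton.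
\<close>

definition tensor_lift ::
  "('k, 'n) ring_scheme \<Rightarrow> ('k, 'z, 'q) module_scheme \<Rightarrow> ('b \<Rightarrow> 'c \<Rightarrow> 'z)
    \<Rightarrow> ('b \<times> 'c \<Rightarrow> 'k) set \<Rightarrow> 'z" where
  "tensor_lift K Z \<beta> X =
    the_elem ((\<lambda>f. \<Oplus>\<^bsub>Z\<^esub>p\<in>{p. f p \<noteq> \<zero>\<^bsub>K\<^esub>}. f p \<odot>\<^bsub>Z\<^esub> \<beta> (fst p) (snd p)) ` X)"

text \<open>\<open>g \<otimes> h\<close> for linear maps \<open>g : B \<rightarrow> B'\<close> and \<open>h : C \<rightarrow> C'\<close>, given the codomains.\<close>

definition tensor_map ::
  "('k, 'n) ring_scheme \<Rightarrow> ('k, 'd, 'm) module_scheme \<Rightarrow> ('k, 'e, 'p) module_scheme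
    \<Rightarrow> ('b \<Rightarrow> 'd) \<Rightarrow> ('c \<Rightarrow> 'e) \<Rightarrow> ('b \<times> 'c \<Rightarrow> 'k) set \<Rightarrow> ('d \<times> 'e \<Rightarrow> 'k) set" where
  "tensor_map K B' C' g h =
    tensor_lift K (tensor_product K B' C') (\<lambda>b c. pure_tensor K B' C' (g b) (h c))"

text \<open>
  The canonical identification \<open>(B \<otimes> C) \<otimes> D \<rightarrow> B \<otimes> (C \<otimes> D)\<close>, \<open>(b \<otimes> c) \<otimes> d \<mapsto> b \<otimes> (c \<otimes> d)\<close>.
\<close>

definition tensor_assoc ::
  "('k, 'n) ring_scheme \<Rightarrow> ('k, 'b, 'm) module_scheme \<Rightarrow> ('k, 'c, 'p) module_scheme
    \<Rightarrow> ('k, 'd, 'q) module_scheme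
    \<Rightarrow> (('b \<times> 'c \<Rightarrow> 'k) set \<times> 'd \<Rightarrow> 'k) set \<Rightarrow> ('b \<times> ('c \<times> 'd \<Rightarrow> 'k) set \<Rightarrow> 'k) set" where
  "tensor_assoc K B C D =
    (let Z = tensor_product K B (tensor_product K C D) in
      tensor_lift K Z (\<lambda>t d. tensor_lift K Z
        (\<lambda>b c. pure_tensor K B (tensor_product K C D) b (pure_tensor K C D c d)) t))"

end

theory Submission
  imports Defs
begin

text \<open>
  Both sides are homomorphisms of unital algebras \<open>U(A) \<rightarrow> U(A) \<otimes> (U(A) \<otimes> U(A))\<close>: the maps
  \<open>1 \<otimes> \<Delta>\<close> and \<open>\<Delta> \<otimes> 1\<close> are tensor products of homomorphisms (\<open>tensor_map_hom\<close>), and rebracketing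
  respects products (\<open>tensor_assoc_hom\<close>).  Since the elements \<open>r\<^sub>a\<close> and \<open>l\<^sub>a\<close> generate \<open>U(A)\<close>
  (\<open>U_induct\<close>, \<open>U_hom_eqI\<close>), it suffices to compare the two sides on these elements.

  On \<open>l\<^sub>a\<close> both give \<open>l\<^sub>a \<otimes> 1 \<otimes> 1\<close>.  For \<open>r\<^sub>a\<close>, put \<open>s = r\<^sub>a - l\<^sub>a\<close>.  Subtracting the given formulas
  shows that \<open>s\<close> is primitive, \<open>\<Delta>(s) = s \<otimes> 1 + 1 \<otimes> s\<close>, and so
  \<open>(1 \<otimes> \<Delta>)(r\<^sub>a \<otimes> 1 + 1 \<otimes> s)\<close> and \<open>(\<Delta> \<otimes> 1)(r\<^sub>a \<otimes> 1 + 1 \<otimes> s)\<close> both equal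
  \<open>r\<^sub>a \<otimes> 1 \<otimes> 1 + 1 \<otimes> s \<otimes> 1 + 1 \<otimes> 1 \<otimes> s\<close>.

  Most of the work is to establish that the algebras involved are algebras and that the maps
  involved are homomorphisms.  The tensor algebra and the tensor product are quotients of monoid
  algebras, where a multilinear identity need only be checked on basis vectors (\<open>F_induct\<close>).  The
  bilinearity relations span an ideal (\<open>N_ideal\<close>), which a bilinear map annihilates
  (\<open>ext_relations\<close>); this gives the universal property \<open>lift_hom\<close>, from which the statements on
  \<open>tensor_map\<close> and \<open>tensor_assoc\<close> follow.
\<close>

section \<open>Unital associative algebras and their quotients\<close>

locale unital_algebra = module K B + B?: ring B
  for K :: "('k, 'n) ring_scheme" and B :: "('k, 'b, 'm) module_scheme" (structure) +
  assumes smult_mult_left: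
      "\<lbrakk>k \<in> carrier K; x \<in> carrier B; y \<in> carrier B\<rbrakk> \<Longrightarrow> (k \<odot> x) \<otimes> y = k \<odot> (x \<otimes> y)"
    and smult_mult_right:
      "\<lbrakk>k \<in> carrier K; x \<in> carrier B; y \<in> carrier B\<rbrakk> \<Longrightarrow> x \<otimes> (k \<odot> y) = k \<odot> (x \<otimes> y)"

context unital_algebra
begin

text \<open>
  A scalar acts on \<open>x\<close> as left multiplication by the element \<open>k 1\<close>, so a ring ideal is
  automatically a subspace.  This is what lets the ideals generated in the sense of rings serve as
  ideals of algebras.
\<close>

lemma smult_ideal:
  assumes "ideal N B" "k \<in> carrier K" "x \<in> N"
  shows "k \<odot> x \<in> N"
proof -
  interpret N: ideal N B by fact
  have "k \<odot> x = (k \<odot> \<one>) \<otimes> x"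
    using assms by (simp add: smult_mult_left)
  also have "\<dots> \<in> N"
    using assms by (simp add: N.I_l_closed)
  finally show ?thesis .
qed

context
  fixes N
  assumes N: "ideal N B"
begin

interpretation N: ideal N B by (rule N)

lemma carrier_quotient: "carrier (quotient_algebra B N) = (+>) N ` carrier B"
  by (auto simp: quotient_algebra_def FactRing_def A_RCOSETS_def')

lemma quotient_add:
  "\<lbrakk>x \<in> carrier B; y \<in> carrier B\<rbrakk> \<Longrightarrow>
    (N +> x) \<oplus>\<^bsub>quotient_algebra B N\<^esub> (N +> y) = N +> (x \<oplus> y)"
  by (simp add: quotient_algebra_def FactRing_def N.a_rcos_sum)

lemma quotient_mult:
  "\<lbrakk>x \<in> carrier B; y \<in> carrier B\<rbrakk> \<Longrightarrow>
    (N +> x) \<otimes>\<^bsub>quotient_algebra B N\<^esub> (N +> y) = N +> (x \<otimes> y)"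
  by (simp add: quotient_algebra_def FactRing_def N.rcoset_mult_add)

lemma quotient_smult:
  assumes "k \<in> carrier K" "x \<in> carrier B"
  shows "k \<odot>\<^bsub>quotient_algebra B N\<^esub> (N +> x) = N +> (k \<odot> x)"
proof -
  have "N +> (k \<odot> y) = N +> (k \<odot> x)" if "y \<in> N +> x" for y
  proof -
    obtain n where n: "n \<in> N" "y = n \<oplus> x"
      using \<open>y \<in> N +> x\<close> by (auto simp: a_r_coset_def')
    then have "k \<odot> y = k \<odot> n \<oplus> k \<odot> x" and "k \<odot> n \<in> N"
      using assms by (auto simp: smult_r_distr smult_ideal[OF N])
    then have "k \<odot> y \<in> N +> (k \<odot> x)"
      by (auto simp: a_r_coset_def')
    then show ?thesis
      using assms N.a_repr_independence'[of "k \<odot> y" "k \<odot> x"] by simp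
  qed
  moreover have "x \<in> N +> x"
    by (simp add: N.a_rcos_self assms)
  ultimately have "(\<Union>y\<in>N +> x. N +> (k \<odot> y)) = N +> (k \<odot> x)"
    by blast
  then show ?thesis
    by (simp add: quotient_algebra_def)
qed

lemma quotient_one: "\<one>\<^bsub>quotient_algebra B N\<^esub> = N +> \<one>"
  by (simp add: quotient_algebra_def FactRing_def)

lemma unital_algebra_quotient: "unital_algebra K (quotient_algebra B N)"
proof -
  let ?Q = "quotient_algebra B N"
  interpret FR: ring "B Quot N"
    by (rule N.quotient_is_ring)
  have fields: "carrier ?Q = carrier (B Quot N)" "mult ?Q = mult (B Quot N)"
    "one ?Q = one (B Quot N)" "zero ?Q = zero (B Quot N)" "add ?Q = add (B Quot N)"
    by (simp_all add: quotient_algebra_def)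
  have "ring ?Q"
    by (intro ringI abelian_groupI monoidI; unfold fields)
      (auto simp: FR.a_ac FR.m_assoc FR.l_distr FR.r_distr intro: FR.l_neg)
  then interpret Q: ring ?Q .
  have "module K ?Q"
    by (rule moduleI)
      (auto simp: carrier_quotient quotient_add quotient_smult R.is_cring Q.is_abelian_group
        smult_l_distr smult_r_distr smult_assoc1)
  then show ?thesis
    by (intro unital_algebra.intro unital_algebra_axioms.intro \<open>ring ?Q\<close>)
      (auto simp: carrier_quotient quotient_mult quotient_smult smult_mult_left smult_mult_right)
qed

lemma quotient_hom: "(+>) N \<in> unital_algebra_hom K B (quotient_algebra B N)"
  by (auto simp: unital_algebra_hom_def ring_hom_def carrier_quotient quotient_mult quotient_add
      quotient_smult quotient_one)

end

end


section \<open>Monoid algebras\<close>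

text \<open>
  The value of \<open>tensor_lift\<close> on a representative of a class; isolating it separates the linear
  algebra on \<open>K[M]\<close> from the passage to the quotient.
\<close>

definition linear_extension ::
  "('k, 'n) ring_scheme \<Rightarrow> ('k, 'z, 'q) module_scheme \<Rightarrow> ('w \<Rightarrow> 'z) \<Rightarrow> ('w \<Rightarrow> 'k) \<Rightarrow> 'z" where
  "linear_extension K Z \<beta> f = (\<Oplus>\<^bsub>Z\<^esub>p\<in>{p. f p \<noteq> \<zero>\<^bsub>K\<^esub>}. f p \<odot>\<^bsub>Z\<^esub> \<beta> p)"

locale monoid_ring = K?: cring K + G?: monoid G
  for K :: "('k, 'n) ring_scheme" (structure) and G :: "('w, 'p) monoid_scheme" (structure)
begin

abbreviation "F \<equiv> monoid_algebra K G"
abbreviation "basis \<equiv> monomial K"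

lemma carrier_F:
  "f \<in> carrier F \<longleftrightarrow>
    (\<forall>w. f w \<in> carrier K) \<and> finite {w. f w \<noteq> \<zero>\<^bsub>K\<^esub>} \<and> {w. f w \<noteq> \<zero>\<^bsub>K\<^esub>} \<subseteq> carrier G"
  by (simp add: monoid_algebra_def)

lemma F_apply:
  "(f \<oplus>\<^bsub>F\<^esub> g) w = f w \<oplus>\<^bsub>K\<^esub> g w" "(k \<odot>\<^bsub>F\<^esub> f) w = k \<otimes>\<^bsub>K\<^esub> f w" "\<zero>\<^bsub>F\<^esub> w = \<zero>\<^bsub>K\<^esub>"
  by (simp_all add: monoid_algebra_def)

lemma F_add_closed:
  assumes "f \<in> carrier F" "g \<in> carrier F"
  shows "f \<oplus>\<^bsub>F\<^esub> g \<in> carrier F"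
proof -
  have *: "{w. f w \<oplus>\<^bsub>K\<^esub> g w \<noteq> \<zero>\<^bsub>K\<^esub>} \<subseteq> {w. f w \<noteq> \<zero>\<^bsub>K\<^esub>} \<union> {w. g w \<noteq> \<zero>\<^bsub>K\<^esub>}"
    by auto
  have "finite {w. f w \<oplus>\<^bsub>K\<^esub> g w \<noteq> \<zero>\<^bsub>K\<^esub>}"
    using assms by (intro finite_subset[OF *]) (simp add: carrier_F)
  moreover have "{w. f w \<oplus>\<^bsub>K\<^esub> g w \<noteq> \<zero>\<^bsub>K\<^esub>} \<subseteq> carrier G"
    using assms by (intro subset_trans[OF *]) (simp add: carrier_F)
  ultimately show ?thesis
    using assms by (simp add: carrier_F F_apply)
qed

lemma F_smult_closed:
  assumes "k \<in> carrier K" "f \<in> carrier F"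
  shows "k \<odot>\<^bsub>F\<^esub> f \<in> carrier F"
proof -
  have *: "{w. k \<otimes>\<^bsub>K\<^esub> f w \<noteq> \<zero>\<^bsub>K\<^esub>} \<subseteq> {w. f w \<noteq> \<zero>\<^bsub>K\<^esub>}"
    using assms by auto
  have "finite {w. k \<otimes>\<^bsub>K\<^esub> f w \<noteq> \<zero>\<^bsub>K\<^esub>}"
    using assms by (intro finite_subset[OF *]) (simp add: carrier_F)
  moreover have "{w. k \<otimes>\<^bsub>K\<^esub> f w \<noteq> \<zero>\<^bsub>K\<^esub>} \<subseteq> carrier G"
    using assms by (intro subset_trans[OF *]) (simp add: carrier_F)
  ultimately show ?thesis
    using assms by (simp add: carrier_F F_apply)
qed

lemma F_zero_closed: "\<zero>\<^bsub>F\<^esub> \<in> carrier F"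
  by (simp add: carrier_F F_apply)

lemma monomial_closed: "w \<in> carrier G \<Longrightarrow> basis w \<in> carrier F"
  by (auto simp: carrier_F monomial_def)

lemma F_coeff_closed: "f \<in> carrier F \<Longrightarrow> f w \<in> carrier K"
  by (simp add: carrier_F)

lemma module_F: "module K F"
proof (rule moduleI)
  show "abelian_group F"
  proof (rule abelian_groupI)
    fix f assume f: "f \<in> carrier F"
    (* The additive inverse of f is (-1) f, which is known to have finite support. *)
    have "(\<ominus>\<^bsub>K\<^esub> \<one>\<^bsub>K\<^esub>) \<odot>\<^bsub>F\<^esub> f \<in> carrier F"
      using f by (intro F_smult_closed) auto
    moreover have "(\<ominus>\<^bsub>K\<^esub> \<one>\<^bsub>K\<^esub>) \<odot>\<^bsub>F\<^esub> f \<oplus>\<^bsub>F\<^esub> f = \<zero>\<^bsub>F\<^esub>"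
      using f by (simp add: F_apply fun_eq_iff F_coeff_closed K.l_minus K.l_neg)
    ultimately show "\<exists>g\<in>carrier F. g \<oplus>\<^bsub>F\<^esub> f = \<zero>\<^bsub>F\<^esub>"
      by blast
  qed (simp_all add: F_add_closed F_zero_closed F_apply fun_eq_iff F_coeff_closed K.a_ac)
qed (simp_all add: F_smult_closed K.is_cring F_apply fun_eq_iff F_coeff_closed K.l_distr K.r_distr K.m_assoc)

sublocale F: module K F
  by (rule module_F)

text \<open>
  Finitely supported functions are finite sums of scaled basis vectors: peel off one point of the
  support at a time.  Every identity that is linear in an argument thereby reduces to basis
  vectors.
\<close>

lemma F_induct [consumes 1, case_names zero basis add]:
  assumes f: "f \<in> carrier F"
    and zero: "P \<zero>\<^bsub>F\<^esub>"
    and basis: "\<And>k w. k \<in> carrier K \<Longrightarrow> w \<in> carrier G \<Longrightarrow> P (k \<odot>\<^bsub>F\<^esub> basis w)"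
    and add: "\<And>f g. f \<in> carrier F \<Longrightarrow> g \<in> carrier F \<Longrightarrow> P f \<Longrightarrow> P g \<Longrightarrow> P (f \<oplus>\<^bsub>F\<^esub> g)"
  shows "P f"
proof -
  have "P f" if "finite S" "f \<in> carrier F" "{w. f w \<noteq> \<zero>\<^bsub>K\<^esub>} \<subseteq> S" "S \<subseteq> carrier G" for f S
    using that
  proof (induction S arbitrary: f rule: finite_induct)
    case empty
    then have "f = \<zero>\<^bsub>F\<^esub>"
      by (auto simp: fun_eq_iff F_apply)
    with zero show ?case
      by simp
  next
    case (insert w S)
    let ?g = "f(w := \<zero>\<^bsub>K\<^esub>)" and ?m = "f w \<odot>\<^bsub>F\<^esub> basis w"
    have "{v. ?g v \<noteq> \<zero>\<^bsub>K\<^esub>} \<subseteq> {v. f v \<noteq> \<zero>\<^bsub>K\<^esub>}"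
      by auto
    then have g: "?g \<in> carrier F"
      using insert.prems(1) unfolding carrier_F by (auto intro: finite_subset)
    have m: "?m \<in> carrier F"
      using insert.prems by (simp add: F_smult_closed monomial_closed F_coeff_closed)
    have "f = ?g \<oplus>\<^bsub>F\<^esub> ?m"
      using insert.prems by (simp add: fun_eq_iff F_apply monomial_def F_coeff_closed)
    moreover have "P ?g"
      using insert.prems by (intro insert.IH g) auto
    moreover have "P ?m"
      using insert.prems by (intro basis) (auto simp: F_coeff_closed)
    ultimately show ?case
      using add g m by metis
  qed
  from this[of "{w. f w \<noteq> \<zero>\<^bsub>K\<^esub>}"] f show ?thesis
    by (simp add: carrier_F)
qed

text \<open>
  The index set in the definition of the convolution depends on the supports of both factors and
  on the point of evaluation.  Spreading the sum over a fixed rectangle that contains the supports,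
  with vanishing extra terms, makes sums of several products comparable; bilinearity is then a
  termwise identity.
\<close>

lemma F_mult_expand:
  assumes f: "f \<in> carrier F" and g: "g \<in> carrier F"
    and S: "finite S" "{u. f u \<noteq> \<zero>\<^bsub>K\<^esub>} \<subseteq> S" and T: "finite T" "{v. g v \<noteq> \<zero>\<^bsub>K\<^esub>} \<subseteq> T"
  shows "(f \<otimes>\<^bsub>F\<^esub> g) w =
    (\<Oplus>\<^bsub>K\<^esub>p\<in>S \<times> T. if fst p \<otimes>\<^bsub>G\<^esub> snd p = w then f (fst p) \<otimes>\<^bsub>K\<^esub> g (snd p) else \<zero>\<^bsub>K\<^esub>)"
proof -
  have "(\<Oplus>\<^bsub>K\<^esub>p\<in>{(u, v). f u \<noteq> \<zero>\<^bsub>K\<^esub> \<and> g v \<noteq> \<zero>\<^bsub>K\<^esub> \<and> u \<otimes>\<^bsub>G\<^esub> v = w}. f (fst p) \<otimes>\<^bsub>K\<^esub> g (snd p)) =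
    (\<Oplus>\<^bsub>K\<^esub>p\<in>S \<times> T. if fst p \<otimes>\<^bsub>G\<^esub> snd p = w then f (fst p) \<otimes>\<^bsub>K\<^esub> g (snd p) else \<zero>\<^bsub>K\<^esub>)"
    by (rule K.add.finprod_mono_neutral_cong_left)
      (use S T F_coeff_closed[OF f] F_coeff_closed[OF g] in auto)
  then show ?thesis
    by (simp add: monoid_algebra_def)
qed

lemma F_mult_closed:
  assumes f: "f \<in> carrier F" and g: "g \<in> carrier F"
  shows "f \<otimes>\<^bsub>F\<^esub> g \<in> carrier F"
proof -
  let ?S = "{u. f u \<noteq> \<zero>\<^bsub>K\<^esub>}" and ?T = "{u. g u \<noteq> \<zero>\<^bsub>K\<^esub>}"
  have fin: "finite ?S" "finite ?T" and sub: "?S \<subseteq> carrier G" "?T \<subseteq> carrier G"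
    using f g by (auto simp: carrier_F)
  note expand = F_mult_expand[OF f g fin(1) subset_refl fin(2) subset_refl]
  let ?I = "(\<lambda>p. fst p \<otimes>\<^bsub>G\<^esub> snd p) ` (?S \<times> ?T)"
  have "(f \<otimes>\<^bsub>F\<^esub> g) w = \<zero>\<^bsub>K\<^esub>" if "w \<notin> ?I" for w
    unfolding expand by (rule K.add.finprod_one_eqI[simplified]) (use that in force)
  then have *: "{w. (f \<otimes>\<^bsub>F\<^esub> g) w \<noteq> \<zero>\<^bsub>K\<^esub>} \<subseteq> ?I"
    by blast
  moreover have "(f \<otimes>\<^bsub>F\<^esub> g) w \<in> carrier K" for w
    unfolding expand
    by (rule K.finsum_closed) (use F_coeff_closed[OF f] F_coeff_closed[OF g] in auto)
  moreover have "?I \<subseteq> carrier G"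
    using sub by (fastforce intro: G.m_closed)
  moreover have "finite ?I"
    using fin by blast
  ultimately show ?thesis
    unfolding carrier_F by (blast intro: finite_subset)
qed

lemma F_mult_add_left:
  assumes f: "f \<in> carrier F" and f': "f' \<in> carrier F" and g: "g \<in> carrier F"
  shows "(f \<oplus>\<^bsub>F\<^esub> f') \<otimes>\<^bsub>F\<^esub> g = f \<otimes>\<^bsub>F\<^esub> g \<oplus>\<^bsub>F\<^esub> f' \<otimes>\<^bsub>F\<^esub> g"
proof
  fix w
  let ?S = "{u. f u \<noteq> \<zero>\<^bsub>K\<^esub>} \<union> {u. f' u \<noteq> \<zero>\<^bsub>K\<^esub>}" and ?T = "{v. g v \<noteq> \<zero>\<^bsub>K\<^esub>}"
  have fin: "finite ?S" "finite ?T"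
    using f f' g by (auto simp: carrier_F)
  have "{u. (f \<oplus>\<^bsub>F\<^esub> f') u \<noteq> \<zero>\<^bsub>K\<^esub>} \<subseteq> ?S"
    by (auto simp: F_apply)
  note expand = F_mult_expand[OF f g fin(1) Un_upper1 fin(2) subset_refl, of w]
    F_mult_expand[OF f' g fin(1) Un_upper2 fin(2) subset_refl, of w]
    F_mult_expand[OF F_add_closed[OF f f'] g fin(1) this fin(2) subset_refl, of w]
  note [simp] = F_coeff_closed[OF f] F_coeff_closed[OF f'] F_coeff_closed[OF g]
  show "((f \<oplus>\<^bsub>F\<^esub> f') \<otimes>\<^bsub>F\<^esub> g) w = (f \<otimes>\<^bsub>F\<^esub> g \<oplus>\<^bsub>F\<^esub> f' \<otimes>\<^bsub>F\<^esub> g) w"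
    unfolding F_apply(1)[of "f \<otimes>\<^bsub>F\<^esub> g"] expand
    by (subst K.finsum_addf[symmetric])
      (auto intro!: K.finsum_cong' simp: F_apply K.l_distr simp del: K.finsum_addf K.add.finprod_multf)
qed

lemma F_mult_add_right:
  assumes f: "f \<in> carrier F" and g: "g \<in> carrier F" and g': "g' \<in> carrier F"
  shows "f \<otimes>\<^bsub>F\<^esub> (g \<oplus>\<^bsub>F\<^esub> g') = f \<otimes>\<^bsub>F\<^esub> g \<oplus>\<^bsub>F\<^esub> f \<otimes>\<^bsub>F\<^esub> g'"
proof
  fix w
  let ?T = "{u. g u \<noteq> \<zero>\<^bsub>K\<^esub>} \<union> {u. g' u \<noteq> \<zero>\<^bsub>K\<^esub>}" and ?S = "{v. f v \<noteq> \<zero>\<^bsub>K\<^esub>}"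
  have fin: "finite ?S" "finite ?T"
    using f g g' by (auto simp: carrier_F)
  have "{u. (g \<oplus>\<^bsub>F\<^esub> g') u \<noteq> \<zero>\<^bsub>K\<^esub>} \<subseteq> ?T"
    by (auto simp: F_apply)
  note expand = F_mult_expand[OF f g fin(1) subset_refl fin(2) Un_upper1, of w]
    F_mult_expand[OF f g' fin(1) subset_refl fin(2) Un_upper2, of w]
    F_mult_expand[OF f F_add_closed[OF g g'] fin(1) subset_refl fin(2) this, of w]
  note [simp] = F_coeff_closed[OF f] F_coeff_closed[OF g] F_coeff_closed[OF g']
  show "(f \<otimes>\<^bsub>F\<^esub> (g \<oplus>\<^bsub>F\<^esub> g')) w = (f \<otimes>\<^bsub>F\<^esub> g \<oplus>\<^bsub>F\<^esub> f \<otimes>\<^bsub>F\<^esub> g') w"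
    unfolding F_apply(1)[of "f \<otimes>\<^bsub>F\<^esub> g"] expand
    by (subst K.finsum_addf[symmetric])
      (auto intro!: K.finsum_cong' simp: F_apply K.r_distr simp del: K.finsum_addf K.add.finprod_multf)
qed

lemma F_mult_smult_left:
  assumes k: "k \<in> carrier K" and f: "f \<in> carrier F" and g: "g \<in> carrier F"
  shows "(k \<odot>\<^bsub>F\<^esub> f) \<otimes>\<^bsub>F\<^esub> g = k \<odot>\<^bsub>F\<^esub> (f \<otimes>\<^bsub>F\<^esub> g)"
proof
  fix w
  let ?S = "{v. f v \<noteq> \<zero>\<^bsub>K\<^esub>}" and ?T = "{u. g u \<noteq> \<zero>\<^bsub>K\<^esub>}"
  have fin: "finite ?S" "finite ?T"
    using f g by (auto simp: carrier_F)
  have "{u. (k \<odot>\<^bsub>F\<^esub> f) u \<noteq> \<zero>\<^bsub>K\<^esub>} \<subseteq> ?S"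
    using k by (auto simp: F_apply)
  note expand = F_mult_expand[OF f g fin(1) subset_refl fin(2) subset_refl, of w]
    F_mult_expand[OF F_smult_closed[OF k f] g fin(1) this fin(2) subset_refl, of w]
  note [simp] = F_coeff_closed[OF f] F_coeff_closed[OF g]
  show "((k \<odot>\<^bsub>F\<^esub> f) \<otimes>\<^bsub>F\<^esub> g) w = (k \<odot>\<^bsub>F\<^esub> (f \<otimes>\<^bsub>F\<^esub> g)) w"
    unfolding F_apply(2)[of k "f \<otimes>\<^bsub>F\<^esub> g"] expand using k fin
    by (subst K.finsum_rdistr)
      (auto intro!: K.finsum_cong' simp: F_apply K.m_assoc)
qed

lemma F_mult_smult_right:
  assumes k: "k \<in> carrier K" and f: "f \<in> carrier F" and g: "g \<in> carrier F"
  shows "f \<otimes>\<^bsub>F\<^esub> (k \<odot>\<^bsub>F\<^esub> g) = k \<odot>\<^bsub>F\<^esub> (f \<otimes>\<^bsub>F\<^esub> g)"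
proof
  fix w
  let ?S = "{v. f v \<noteq> \<zero>\<^bsub>K\<^esub>}" and ?T = "{u. g u \<noteq> \<zero>\<^bsub>K\<^esub>}"
  have fin: "finite ?S" "finite ?T"
    using f g by (auto simp: carrier_F)
  have "{u. (k \<odot>\<^bsub>F\<^esub> g) u \<noteq> \<zero>\<^bsub>K\<^esub>} \<subseteq> ?T"
    using k by (auto simp: F_apply)
  note expand = F_mult_expand[OF f g fin(1) subset_refl fin(2) subset_refl, of w]
    F_mult_expand[OF f F_smult_closed[OF k g] fin(1) subset_refl fin(2) this, of w]
  note [simp] = F_coeff_closed[OF f] F_coeff_closed[OF g]
  show "(f \<otimes>\<^bsub>F\<^esub> (k \<odot>\<^bsub>F\<^esub> g)) w = (k \<odot>\<^bsub>F\<^esub> (f \<otimes>\<^bsub>F\<^esub> g)) w"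
    unfolding F_apply(2)[of k "f \<otimes>\<^bsub>F\<^esub> g"] expand using k fin
    by (subst K.finsum_rdistr)
      (auto intro!: K.finsum_cong' simp: F_apply K.m_ac)
qed

lemma F_mult_basis:
  assumes u: "u \<in> carrier G" and v: "v \<in> carrier G"
  shows "basis u \<otimes>\<^bsub>F\<^esub> basis v = basis (u \<otimes>\<^bsub>G\<^esub> v)"
proof
  fix w
  have "(basis u \<otimes>\<^bsub>F\<^esub> basis v) w = (\<Oplus>\<^bsub>K\<^esub>p\<in>{u} \<times> {v}.
      if fst p \<otimes>\<^bsub>G\<^esub> snd p = w then basis u (fst p) \<otimes>\<^bsub>K\<^esub> basis v (snd p) else \<zero>\<^bsub>K\<^esub>)"
    by (rule F_mult_expand) (auto simp: monomial_closed u v, auto simp: monomial_def split: if_splits)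
  also have "\<dots> = basis (u \<otimes>\<^bsub>G\<^esub> v) w"
    by (auto simp: monomial_def)
  finally show "(basis u \<otimes>\<^bsub>F\<^esub> basis v) w = basis (u \<otimes>\<^bsub>G\<^esub> v) w" .
qed

lemma F_one: "\<one>\<^bsub>F\<^esub> = basis \<one>\<^bsub>G\<^esub>"
  by (simp add: monoid_algebra_def monomial_def)

lemma F_zero_mult: "f \<in> carrier F \<Longrightarrow> \<zero>\<^bsub>F\<^esub> \<otimes>\<^bsub>F\<^esub> f = \<zero>\<^bsub>F\<^esub>"
  using F_mult_smult_left[of "\<zero>\<^bsub>K\<^esub>" "\<zero>\<^bsub>F\<^esub>" f] by (simp add: F_zero_closed F_mult_closed)

lemma F_mult_zero: "f \<in> carrier F \<Longrightarrow> f \<otimes>\<^bsub>F\<^esub> \<zero>\<^bsub>F\<^esub> = \<zero>\<^bsub>F\<^esub>"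
  using F_mult_smult_right[of "\<zero>\<^bsub>K\<^esub>" f "\<zero>\<^bsub>F\<^esub>"] by (simp add: F_zero_closed F_mult_closed)

lemmas F_bilinear = F_mult_add_left F_mult_add_right F_mult_smult_left F_mult_smult_right
  F_zero_mult F_mult_zero F_mult_closed F_add_closed F_smult_closed F_zero_closed monomial_closed

text \<open>
  Both sides are linear in each factor, and on basis vectors the identity is associativity of the
  monoid.
\<close>

lemma F_mult_assoc:
  assumes "f \<in> carrier F" "g \<in> carrier F" "h \<in> carrier F"
  shows "(f \<otimes>\<^bsub>F\<^esub> g) \<otimes>\<^bsub>F\<^esub> h = f \<otimes>\<^bsub>F\<^esub> (g \<otimes>\<^bsub>F\<^esub> h)"
  using assms(1)
proof (induction rule: F_induct)
  case u: (basis k u)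
  show ?case
    using assms(2)
  proof (induction rule: F_induct)
    case v: (basis k' v)
    show ?case
      using assms(3)
      by (induction rule: F_induct)
        (use u v in \<open>simp_all add: F_bilinear F_mult_basis G.m_assoc\<close>)
  qed (use u assms in \<open>simp_all add: F_bilinear\<close>)
qed (use assms in \<open>simp_all add: F_bilinear\<close>)

lemma F_unit:
  assumes "f \<in> carrier F"
  shows "\<one>\<^bsub>F\<^esub> \<otimes>\<^bsub>F\<^esub> f = f" "f \<otimes>\<^bsub>F\<^esub> \<one>\<^bsub>F\<^esub> = f"
  using assms
  by (induction rule: F_induct) (simp_all add: F_one F_bilinear F_mult_basis)

lemma unital_algebra_F: "unital_algebra K F"
proof (intro unital_algebra.intro unital_algebra_axioms.intro)
  show "ring F"
    by (rule ringI)
      (auto simp: F_bilinear F_mult_assoc F_unit F_unit[unfolded F_one] F_one F.M.abelian_group_axioms intro!: monoidI)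
qed (auto simp: F_bilinear module_F)

sublocale F: unital_algebra K F
  by (rule unital_algebra_F)

context
  fixes Z :: "('k, 'z, 'q) module_scheme" and \<beta> :: "'w \<Rightarrow> 'z"
  assumes Z: "module K Z" and \<beta>_funcset: "\<beta> \<in> carrier G \<rightarrow> carrier Z"
begin

private lemma \<beta>: "w \<in> carrier G \<Longrightarrow> \<beta> w \<in> carrier Z"
  using \<beta>_funcset by blast

interpretation Z: module K Z by (rule Z)

text \<open>
  As for the convolution, a sum over a fixed finite set replaces the one over the support, so that
  extensions of different functions can be added termwise.
\<close>

lemma linear_extension_expand:
  assumes f: "f \<in> carrier F" and S: "finite S" "{w. f w \<noteq> \<zero>\<^bsub>K\<^esub>} \<subseteq> S" "S \<subseteq> carrier G"
  shows "linear_extension K Z \<beta> f = (\<Oplus>\<^bsub>Z\<^esub>w\<in>S. f w \<odot>\<^bsub>Z\<^esub> \<beta> w)"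
  unfolding linear_extension_def
  by (rule Z.M.add.finprod_mono_neutral_cong_left)
    (use S \<beta> F_coeff_closed[OF f] in auto)

lemma linear_extension_closed:
  assumes f: "f \<in> carrier F"
  shows "linear_extension K Z \<beta> f \<in> carrier Z"
  unfolding linear_extension_def
  by (rule Z.M.finsum_closed) (use f \<beta> in \<open>auto simp: carrier_F\<close>)

lemma linear_extension_add:
  assumes f: "f \<in> carrier F" and g: "g \<in> carrier F"
  shows "linear_extension K Z \<beta> (f \<oplus>\<^bsub>F\<^esub> g) = linear_extension K Z \<beta> f \<oplus>\<^bsub>Z\<^esub> linear_extension K Z \<beta> g"
proof -
  let ?S = "{u. f u \<noteq> \<zero>\<^bsub>K\<^esub>} \<union> {u. g u \<noteq> \<zero>\<^bsub>K\<^esub>}"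
  have fin: "finite ?S" and sub: "?S \<subseteq> carrier G"
    using f g by (auto simp: carrier_F)
  have "{u. (f \<oplus>\<^bsub>F\<^esub> g) u \<noteq> \<zero>\<^bsub>K\<^esub>} \<subseteq> ?S"
    by (auto simp: F_apply)
  note expand = linear_extension_expand[OF f fin Un_upper1 sub]
    linear_extension_expand[OF g fin Un_upper2 sub]
    linear_extension_expand[OF F_add_closed[OF f g] fin this sub]
  show ?thesis
    unfolding expand using sub F_coeff_closed[OF f] F_coeff_closed[OF g] \<beta>
    by (subst Z.M.finsum_addf[symmetric])
      (auto intro!: Z.M.finsum_cong' simp: F_apply Z.smult_l_distr subset_iff
        simp del: Z.M.finsum_addf Z.M.add.finprod_multf)
qed

lemma linear_extension_smult:
  assumes k: "k \<in> carrier K" and f: "f \<in> carrier F"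
  shows "linear_extension K Z \<beta> (k \<odot>\<^bsub>F\<^esub> f) = k \<odot>\<^bsub>Z\<^esub> linear_extension K Z \<beta> f"
proof -
  let ?S = "{u. f u \<noteq> \<zero>\<^bsub>K\<^esub>}"
  have fin: "finite ?S" and sub: "?S \<subseteq> carrier G"
    using f by (auto simp: carrier_F)
  have "{u. (k \<odot>\<^bsub>F\<^esub> f) u \<noteq> \<zero>\<^bsub>K\<^esub>} \<subseteq> ?S"
    using k by (auto simp: F_apply)
  note expand = linear_extension_expand[OF f fin subset_refl sub]
    linear_extension_expand[OF F_smult_closed[OF k f] fin this sub]
  show ?thesis
    unfolding expand using sub F_coeff_closed[OF f] \<beta> k fin
    by (subst Z.finsum_smult_ldistr)
      (auto intro!: Z.M.finsum_cong' simp: F_apply Z.smult_assoc1 subset_iff)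
qed

lemma linear_extension_basis:
  assumes "w \<in> carrier G"
  shows "linear_extension K Z \<beta> (basis w) = \<beta> w"
proof -
  have "linear_extension K Z \<beta> (basis w) = (\<Oplus>\<^bsub>Z\<^esub>u\<in>{w}. basis w u \<odot>\<^bsub>Z\<^esub> \<beta> u)"
    by (rule linear_extension_expand)
      (use assms in \<open>auto simp: monomial_closed, auto simp: monomial_def split: if_splits\<close>)
  also have "\<dots> = \<beta> w"
    using \<beta>[OF assms] by (simp add: monomial_def)
  finally show ?thesis .
qed

lemma linear_extension_zero: "linear_extension K Z \<beta> \<zero>\<^bsub>F\<^esub> = \<zero>\<^bsub>Z\<^esub>"
  by (simp add: linear_extension_def F_apply)

lemma linear_extension_a_inv:
  assumes f: "f \<in> carrier F"
  shows "linear_extension K Z \<beta> (\<ominus>\<^bsub>F\<^esub> f) = \<ominus>\<^bsub>Z\<^esub> linear_extension K Z \<beta> f"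
  using linear_extension_smult[of "\<ominus>\<^bsub>K\<^esub> \<one>\<^bsub>K\<^esub>" f] linear_extension_closed[OF f] f
  by (simp add: F.smult_l_minus Z.smult_l_minus)

end

end


section \<open>Tensor products of algebras\<close>

definition bilinear_map where
  "bilinear_map K B C Z \<beta> \<longleftrightarrow>
    (\<forall>b\<in>carrier B. \<forall>c\<in>carrier C. \<beta> b c \<in> carrier Z) \<and>
    (\<forall>b\<in>carrier B. \<forall>b'\<in>carrier B. \<forall>c\<in>carrier C. \<beta> (b \<oplus>\<^bsub>B\<^esub> b') c = \<beta> b c \<oplus>\<^bsub>Z\<^esub> \<beta> b' c) \<and>
    (\<forall>b\<in>carrier B. \<forall>c\<in>carrier C. \<forall>c'\<in>carrier C. \<beta> b (c \<oplus>\<^bsub>C\<^esub> c') = \<beta> b c \<oplus>\<^bsub>Z\<^esub> \<beta> b c') \<and>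
    (\<forall>k\<in>carrier K. \<forall>b\<in>carrier B. \<forall>c\<in>carrier C.
      \<beta> (k \<odot>\<^bsub>B\<^esub> b) c = k \<odot>\<^bsub>Z\<^esub> \<beta> b c \<and> \<beta> b (k \<odot>\<^bsub>C\<^esub> c) = k \<odot>\<^bsub>Z\<^esub> \<beta> b c)"

locale algebra_pair = B: unital_algebra K B + C: unital_algebra K C
  for K :: "('k, 'n) ring_scheme" and B :: "('k, 'b, 'm) module_scheme"
    and C :: "('k, 'c, 'p) module_scheme"
begin

sublocale BC: monoid_ring K "B \<times>\<times> C"
  by (intro monoid_ring.intro B.R.is_cring DirProd_monoid B.B.is_monoid C.B.is_monoid)

abbreviation "F \<equiv> monoid_algebra K (B \<times>\<times> C)"
abbreviation "e \<equiv> monomial K"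
abbreviation "N \<equiv> tensor_relations K B C"
abbreviation "BC \<equiv> tensor_product K B C"
abbreviation tensor (infixl \<open>\<otimes>\<^sub>K\<close> 75) where "b \<otimes>\<^sub>K c \<equiv> pure_tensor K B C b c"

definition relators where
  "relators =
    {e (b \<oplus>\<^bsub>B\<^esub> b', c) \<ominus>\<^bsub>F\<^esub> e (b, c) \<ominus>\<^bsub>F\<^esub> e (b', c) | b b' c.
        b \<in> carrier B \<and> b' \<in> carrier B \<and> c \<in> carrier C}
     \<union> {e (b, c \<oplus>\<^bsub>C\<^esub> c') \<ominus>\<^bsub>F\<^esub> e (b, c) \<ominus>\<^bsub>F\<^esub> e (b, c') | b c c'.
        b \<in> carrier B \<and> c \<in> carrier C \<and> c' \<in> carrier C}
     \<union> {e (k \<odot>\<^bsub>B\<^esub> b, c) \<ominus>\<^bsub>F\<^esub> k \<odot>\<^bsub>F\<^esub> e (b, c) | k b c.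
        k \<in> carrier K \<and> b \<in> carrier B \<and> c \<in> carrier C}
     \<union> {e (b, k \<odot>\<^bsub>C\<^esub> c) \<ominus>\<^bsub>F\<^esub> k \<odot>\<^bsub>F\<^esub> e (b, c) | k b c.
        k \<in> carrier K \<and> b \<in> carrier B \<and> c \<in> carrier C}"

lemma N_eq: "N = submodule_span K F relators"
  unfolding tensor_relations_def relators_def Let_def ..

lemma relators_cases [consumes 1, case_names add_left add_right smult_left smult_right]:
  assumes "x \<in> relators"
    and "\<And>b b' c. b \<in> carrier B \<Longrightarrow> b' \<in> carrier B \<Longrightarrow> c \<in> carrier C \<Longrightarrow>
      P (e (b \<oplus>\<^bsub>B\<^esub> b', c) \<ominus>\<^bsub>F\<^esub> e (b, c) \<ominus>\<^bsub>F\<^esub> e (b', c))"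
    and "\<And>b c c'. b \<in> carrier B \<Longrightarrow> c \<in> carrier C \<Longrightarrow> c' \<in> carrier C \<Longrightarrow>
      P (e (b, c \<oplus>\<^bsub>C\<^esub> c') \<ominus>\<^bsub>F\<^esub> e (b, c) \<ominus>\<^bsub>F\<^esub> e (b, c'))"
    and "\<And>k b c. k \<in> carrier K \<Longrightarrow> b \<in> carrier B \<Longrightarrow> c \<in> carrier C \<Longrightarrow>
      P (e (k \<odot>\<^bsub>B\<^esub> b, c) \<ominus>\<^bsub>F\<^esub> k \<odot>\<^bsub>F\<^esub> e (b, c))"
    and "\<And>k b c. k \<in> carrier K \<Longrightarrow> b \<in> carrier B \<Longrightarrow> c \<in> carrier C \<Longrightarrow>
      P (e (b, k \<odot>\<^bsub>C\<^esub> c) \<ominus>\<^bsub>F\<^esub> k \<odot>\<^bsub>F\<^esub> e (b, c))"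
  shows "P x"
  using assms(1) unfolding relators_def
  by (elim UnE CollectE exE conjE; simp only: assms(2-))

lemma relatorsI:
  "\<lbrakk>b \<in> carrier B; b' \<in> carrier B; c \<in> carrier C\<rbrakk> \<Longrightarrow>
    e (b \<oplus>\<^bsub>B\<^esub> b', c) \<ominus>\<^bsub>F\<^esub> e (b, c) \<ominus>\<^bsub>F\<^esub> e (b', c) \<in> relators"
  "\<lbrakk>b \<in> carrier B; c \<in> carrier C; c' \<in> carrier C\<rbrakk> \<Longrightarrow>
    e (b, c \<oplus>\<^bsub>C\<^esub> c') \<ominus>\<^bsub>F\<^esub> e (b, c) \<ominus>\<^bsub>F\<^esub> e (b, c') \<in> relators"
  "\<lbrakk>k \<in> carrier K; b \<in> carrier B; c \<in> carrier C\<rbrakk> \<Longrightarrow>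
    e (k \<odot>\<^bsub>B\<^esub> b, c) \<ominus>\<^bsub>F\<^esub> k \<odot>\<^bsub>F\<^esub> e (b, c) \<in> relators"
  "\<lbrakk>k \<in> carrier K; b \<in> carrier B; c \<in> carrier C\<rbrakk> \<Longrightarrow>
    e (b, k \<odot>\<^bsub>C\<^esub> c) \<ominus>\<^bsub>F\<^esub> k \<odot>\<^bsub>F\<^esub> e (b, c) \<in> relators"
  unfolding relators_def by blast+

lemma e_closed: "\<lbrakk>b \<in> carrier B; c \<in> carrier C\<rbrakk> \<Longrightarrow> e (b, c) \<in> carrier F"
  by (rule BC.monomial_closed) simp

lemma relators_subset: "relators \<subseteq> carrier F"
proof
  fix x assume "x \<in> relators" then show "x \<in> carrier F"
    by (rule relators_cases)
      (simp_all add: e_closed BC.F_smult_closed BC.F.M.minus_closed)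
qed

lemma relators_N: "x \<in> relators \<Longrightarrow> x \<in> N"
  by (auto simp: N_eq submodule_span_def)

lemma N_minimal: "submodule M K F \<Longrightarrow> relators \<subseteq> M \<Longrightarrow> N \<subseteq> M"
  by (auto simp: N_eq submodule_span_def)

lemma N_submodule: "submodule N K F"
proof (rule BC.F.submoduleI)
  have F: "submodule (carrier F) K F"
    by (rule BC.F.carrier_is_submodule)
  then show "N \<subseteq> carrier F"
    by (rule N_minimal[OF _ relators_subset])
  have "\<zero>\<^bsub>F\<^esub> \<in> M" if "submodule M K F" for M
    using subgroup.one_closed[OF submodule.axioms(1)[OF that]] by simp
  then show "\<zero>\<^bsub>F\<^esub> \<in> N"
    by (simp add: N_eq submodule_span_def)
qed (auto simp: N_eq submodule_span_def BC.F.submoduleE)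

lemma e_mult:
  "\<lbrakk>b \<in> carrier B; c \<in> carrier C; b' \<in> carrier B; c' \<in> carrier C\<rbrakk> \<Longrightarrow>
    e (b, c) \<otimes>\<^bsub>F\<^esub> e (b', c') = e (b \<otimes>\<^bsub>B\<^esub> b', c \<otimes>\<^bsub>C\<^esub> c')"
  by (simp add: BC.F_mult_basis)

lemma F_mult_minus:
  "\<lbrakk>x \<in> carrier F; y \<in> carrier F; z \<in> carrier F\<rbrakk> \<Longrightarrow> x \<otimes>\<^bsub>F\<^esub> (y \<ominus>\<^bsub>F\<^esub> z) = x \<otimes>\<^bsub>F\<^esub> y \<ominus>\<^bsub>F\<^esub> x \<otimes>\<^bsub>F\<^esub> z"
  "\<lbrakk>x \<in> carrier F; y \<in> carrier F; z \<in> carrier F\<rbrakk> \<Longrightarrow> (y \<ominus>\<^bsub>F\<^esub> z) \<otimes>\<^bsub>F\<^esub> x = y \<otimes>\<^bsub>F\<^esub> x \<ominus>\<^bsub>F\<^esub> z \<otimes>\<^bsub>F\<^esub> x"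
  by (simp_all add: a_minus_def BC.F.B.r_distr BC.F.B.l_distr BC.F.B.r_minus BC.F.B.l_minus)

text \<open>
  Multiplying by a basis vector \<open>b\<^sub>0 \<otimes> c\<^sub>0\<close> is linear in each tensor factor, so it takes each of the
  four kinds of bilinearity relation to a relation of the same kind.
\<close>

lemma e_mult_relators:
  assumes b0: "b0 \<in> carrier B" and c0: "c0 \<in> carrier C" and x: "x \<in> relators"
  shows "e (b0, c0) \<otimes>\<^bsub>F\<^esub> x \<in> relators" "x \<otimes>\<^bsub>F\<^esub> e (b0, c0) \<in> relators"
proof -
  note simps = F_mult_minus e_closed BC.F_smult_closed e_mult B.B.r_distr B.B.l_distr C.B.r_distr
    C.B.l_distr B.smult_mult_left B.smult_mult_right C.smult_mult_left C.smult_mult_right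
    BC.F_mult_smult_left BC.F_mult_smult_right relatorsI
  show "e (b0, c0) \<otimes>\<^bsub>F\<^esub> x \<in> relators"
    using x by (rule relators_cases) (simp_all add: b0 c0 simps)
  show "x \<otimes>\<^bsub>F\<^esub> e (b0, c0) \<in> relators"
    using x by (rule relators_cases) (simp_all add: b0 c0 simps)
qed

text \<open>
  By linearity it suffices to multiply by basis vectors, and the elements that such a product keeps
  inside the span form a subspace containing the relators.
\<close>

lemma N_ideal: "ideal N F"
proof (rule idealI)
  note N = BC.F.submoduleE[OF N_submodule]
  have zero: "\<zero>\<^bsub>F\<^esub> \<in> N"
    using submodule.axioms(1)[OF N_submodule] by (auto dest: subgroup.one_closed)
  have e_mult_N: "e w \<otimes>\<^bsub>F\<^esub> x \<in> N \<and> x \<otimes>\<^bsub>F\<^esub> e w \<in> N"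
    if w: "w \<in> carrier (B \<times>\<times> C)" and x: "x \<in> N" for w x
  proof -
    have ew: "e w \<in> carrier F"
      using w by (rule BC.monomial_closed)
    have "submodule {x \<in> carrier F. e w \<otimes>\<^bsub>F\<^esub> x \<in> N} K F"
      by (rule BC.F.submoduleI)
        (use ew zero in \<open>auto simp: BC.F_bilinear BC.F.B.r_minus N\<close>)
    then have "N \<subseteq> {x \<in> carrier F. e w \<otimes>\<^bsub>F\<^esub> x \<in> N}"
      by (rule N_minimal)
        (use w relators_subset in \<open>auto intro!: relators_N e_mult_relators\<close>)
    moreover have "submodule {x \<in> carrier F. x \<otimes>\<^bsub>F\<^esub> e w \<in> N} K F"
      by (rule BC.F.submoduleI)
        (use ew zero in \<open>auto simp: BC.F_bilinear BC.F.B.l_minus N\<close>)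
    then have "N \<subseteq> {x \<in> carrier F. x \<otimes>\<^bsub>F\<^esub> e w \<in> N}"
      by (rule N_minimal)
        (use w relators_subset in \<open>auto intro!: relators_N e_mult_relators\<close>)
    ultimately show ?thesis
      using x by blast
  qed
  fix x f
  assume x: "x \<in> N" and f: "f \<in> carrier F"
  then have xF: "x \<in> carrier F"
    using N(1) by blast
  from f show "f \<otimes>\<^bsub>F\<^esub> x \<in> N"
    by (induction rule: BC.F_induct)
      (use x xF e_mult_N in \<open>simp_all add: BC.F_bilinear zero N\<close>)
  from f show "x \<otimes>\<^bsub>F\<^esub> f \<in> N"
    by (induction rule: BC.F_induct)
      (use x xF e_mult_N in \<open>simp_all add: BC.F_bilinear zero N\<close>)
qed (use N_submodule BC.F.B.ring_axioms in \<open>auto dest: submodule.axioms\<close>)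

interpretation N: ideal N F by (rule N_ideal)

lemma unital_algebra_tensor: "unital_algebra K BC"
  unfolding tensor_product_def by (rule BC.F.unital_algebra_quotient[OF N_ideal])

sublocale T: unital_algebra K BC
  by (rule unital_algebra_tensor)

lemma coset_ops:
  "\<lbrakk>f \<in> carrier F; g \<in> carrier F\<rbrakk> \<Longrightarrow> (N +>\<^bsub>F\<^esub> f) \<oplus>\<^bsub>BC\<^esub> (N +>\<^bsub>F\<^esub> g) = N +>\<^bsub>F\<^esub> (f \<oplus>\<^bsub>F\<^esub> g)"
  "\<lbrakk>f \<in> carrier F; g \<in> carrier F\<rbrakk> \<Longrightarrow> (N +>\<^bsub>F\<^esub> f) \<otimes>\<^bsub>BC\<^esub> (N +>\<^bsub>F\<^esub> g) = N +>\<^bsub>F\<^esub> (f \<otimes>\<^bsub>F\<^esub> g)"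
  "\<lbrakk>k \<in> carrier K; f \<in> carrier F\<rbrakk> \<Longrightarrow> k \<odot>\<^bsub>BC\<^esub> (N +>\<^bsub>F\<^esub> f) = N +>\<^bsub>F\<^esub> (k \<odot>\<^bsub>F\<^esub> f)"
  unfolding tensor_product_def
  by (simp_all add: BC.F.quotient_add[OF N_ideal] BC.F.quotient_mult[OF N_ideal]
      BC.F.quotient_smult[OF N_ideal])

lemma carrier_tensor: "carrier BC = (+>\<^bsub>F\<^esub>) N ` carrier F"
  unfolding tensor_product_def by (rule BC.F.carrier_quotient[OF N_ideal])

lemma tensor_one: "\<one>\<^bsub>BC\<^esub> = \<one>\<^bsub>B\<^esub> \<otimes>\<^sub>K \<one>\<^bsub>C\<^esub>"
  by (simp add: tensor_product_def BC.F.quotient_one[OF N_ideal] BC.F_one pure_tensor_def)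

lemma tensor_closed: "\<lbrakk>b \<in> carrier B; c \<in> carrier C\<rbrakk> \<Longrightarrow> b \<otimes>\<^sub>K c \<in> carrier BC"
  by (simp add: carrier_tensor pure_tensor_def e_closed)

lemma tensor_mult:
  "\<lbrakk>b \<in> carrier B; c \<in> carrier C; b' \<in> carrier B; c' \<in> carrier C\<rbrakk> \<Longrightarrow>
    (b \<otimes>\<^sub>K c) \<otimes>\<^bsub>BC\<^esub> (b' \<otimes>\<^sub>K c') = (b \<otimes>\<^bsub>B\<^esub> b') \<otimes>\<^sub>K (c \<otimes>\<^bsub>C\<^esub> c')"
  by (simp add: pure_tensor_def coset_ops e_closed e_mult)

lemma coset_eqI:
  assumes "f \<in> carrier F" "g \<in> carrier F" "f \<ominus>\<^bsub>F\<^esub> g \<in> N"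
  shows "N +>\<^bsub>F\<^esub> f = N +>\<^bsub>F\<^esub> g"
  using assms by (metis N.a_repr_independence' N.a_rcos_module_minus BC.F.B.ring_axioms)

lemma tensor_add_left:
  assumes "b \<in> carrier B" "b' \<in> carrier B" "c \<in> carrier C"
  shows "(b \<oplus>\<^bsub>B\<^esub> b') \<otimes>\<^sub>K c = b \<otimes>\<^sub>K c \<oplus>\<^bsub>BC\<^esub> b' \<otimes>\<^sub>K c"
proof -
  have "e (b \<oplus>\<^bsub>B\<^esub> b', c) \<ominus>\<^bsub>F\<^esub> (e (b, c) \<oplus>\<^bsub>F\<^esub> e (b', c)) = e (b \<oplus>\<^bsub>B\<^esub> b', c) \<ominus>\<^bsub>F\<^esub> e (b, c) \<ominus>\<^bsub>F\<^esub> e (b', c)"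
    using assms by (simp add: a_minus_def e_closed BC.F.M.minus_add BC.F.M.a_assoc)
  then show ?thesis
    using relators_N[OF relatorsI(1)[OF assms]] assms
    by (simp add: pure_tensor_def coset_ops e_closed coset_eqI)
qed

lemma tensor_add_right:
  assumes "b \<in> carrier B" "c \<in> carrier C" "c' \<in> carrier C"
  shows "b \<otimes>\<^sub>K (c \<oplus>\<^bsub>C\<^esub> c') = b \<otimes>\<^sub>K c \<oplus>\<^bsub>BC\<^esub> b \<otimes>\<^sub>K c'"
proof -
  have "e (b, c \<oplus>\<^bsub>C\<^esub> c') \<ominus>\<^bsub>F\<^esub> (e (b, c) \<oplus>\<^bsub>F\<^esub> e (b, c')) = e (b, c \<oplus>\<^bsub>C\<^esub> c') \<ominus>\<^bsub>F\<^esub> e (b, c) \<ominus>\<^bsub>F\<^esub> e (b, c')"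
    using assms by (simp add: a_minus_def e_closed BC.F.M.minus_add BC.F.M.a_assoc)
  then show ?thesis
    using relators_N[OF relatorsI(2)[OF assms]] assms
    by (simp add: pure_tensor_def coset_ops e_closed coset_eqI)
qed

lemma tensor_smult_left:
  assumes "k \<in> carrier K" "b \<in> carrier B" "c \<in> carrier C"
  shows "(k \<odot>\<^bsub>B\<^esub> b) \<otimes>\<^sub>K c = k \<odot>\<^bsub>BC\<^esub> (b \<otimes>\<^sub>K c)"
  using relators_N[OF relatorsI(3)[OF assms]] assms
  by (simp add: pure_tensor_def coset_ops e_closed coset_eqI)

lemma tensor_smult_right:
  assumes "k \<in> carrier K" "b \<in> carrier B" "c \<in> carrier C"
  shows "b \<otimes>\<^sub>K (k \<odot>\<^bsub>C\<^esub> c) = k \<odot>\<^bsub>BC\<^esub> (b \<otimes>\<^sub>K c)"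
  using relators_N[OF relatorsI(4)[OF assms]] assms
  by (simp add: pure_tensor_def coset_ops e_closed coset_eqI)

text \<open>
  Scalars can be moved into the first factor, \<open>k (b \<otimes> c) = (k b) \<otimes> c\<close>, so sums of pure tensors
  exhaust the tensor product and no separate case for scalar multiples or zero is needed.
\<close>

lemma tensor_induct [consumes 1, case_names pure add]:
  assumes "x \<in> carrier BC"
    and pure: "\<And>b c. b \<in> carrier B \<Longrightarrow> c \<in> carrier C \<Longrightarrow> P (b \<otimes>\<^sub>K c)"
    and add: "\<And>x y. x \<in> carrier BC \<Longrightarrow> y \<in> carrier BC \<Longrightarrow> P x \<Longrightarrow> P y \<Longrightarrow> P (x \<oplus>\<^bsub>BC\<^esub> y)"
  shows "P x"
proof -
  have smult_pure: "P (k \<odot>\<^bsub>BC\<^esub> (b \<otimes>\<^sub>K c))" if "k \<in> carrier K" "b \<in> carrier B" "c \<in> carrier C" for k b c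
    using pure[of "k \<odot>\<^bsub>B\<^esub> b" c] that by (simp add: tensor_smult_left)
  obtain f where f: "f \<in> carrier F" "x = N +>\<^bsub>F\<^esub> f"
    using assms(1) by (auto simp: carrier_tensor)
  have "P (N +>\<^bsub>F\<^esub> f)"
    using f(1)
  proof (induction rule: BC.F_induct)
    case zero
    have "N +>\<^bsub>F\<^esub> \<zero>\<^bsub>F\<^esub> = \<zero>\<^bsub>K\<^esub> \<odot>\<^bsub>BC\<^esub> (\<one>\<^bsub>B\<^esub> \<otimes>\<^sub>K \<one>\<^bsub>C\<^esub>)"
      by (simp add: pure_tensor_def coset_ops e_closed)
    then show ?case
      by (simp add: smult_pure)
  next
    case (basis k w)
    obtain b c where w: "w = (b, c)"
      by (cases w)
    show ?case
      using smult_pure[of k b c] basis w by (simp add: pure_tensor_def coset_ops e_closed)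
  next
    case (add f g)
    then have "P ((N +>\<^bsub>F\<^esub> f) \<oplus>\<^bsub>BC\<^esub> (N +>\<^bsub>F\<^esub> g))"
      by (intro assms(3)) (auto simp: carrier_tensor)
    then show ?case
      using add.hyps by (simp add: coset_ops)
  qed
  with f(2) show ?thesis
    by simp
qed

context
  fixes Z :: "('k, 'z, 'q) module_scheme" and \<beta> :: "'b \<Rightarrow> 'c \<Rightarrow> 'z"
  assumes Z: "module K Z" and \<beta>: "bilinear_map K B C Z \<beta>"
begin

interpretation Z: module K Z by (rule Z)

private abbreviation (input) "lift \<equiv> tensor_lift K Z \<beta>"
private abbreviation (input) "ext \<equiv> linear_extension K Z (\<lambda>p. \<beta> (fst p) (snd p))"

lemma \<beta>_closed: "(\<lambda>p. \<beta> (fst p) (snd p)) \<in> carrier (B \<times>\<times> C) \<rightarrow> carrier Z"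
  using \<beta> by (auto simp: bilinear_map_def)

lemmas ext = BC.linear_extension_add[OF Z \<beta>_closed] BC.linear_extension_smult[OF Z \<beta>_closed]
  BC.linear_extension_basis[OF Z \<beta>_closed] BC.linear_extension_a_inv[OF Z \<beta>_closed]
  BC.linear_extension_zero[OF Z \<beta>_closed] BC.linear_extension_closed[OF Z \<beta>_closed]

text \<open>
  The kernel of the extension is a subspace, and bilinearity of \<open>\<beta>\<close> says exactly that the relators
  lie in it.  Hence \<open>tensor_lift\<close> may be evaluated on any representative.
\<close>

lemma ext_relations:
  assumes "x \<in> N"
  shows "ext x = \<zero>\<^bsub>Z\<^esub>"
proof -
  let ?ker = "{x \<in> carrier F. ext x = \<zero>\<^bsub>Z\<^esub>}"
  have "submodule ?ker K F"
    by (intro BC.F.submoduleI) (auto simp: ext)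
  moreover have "relators \<subseteq> ?ker"
  proof
    have cancel: "y \<oplus>\<^bsub>Z\<^esub> z \<oplus>\<^bsub>Z\<^esub> \<ominus>\<^bsub>Z\<^esub> y \<oplus>\<^bsub>Z\<^esub> \<ominus>\<^bsub>Z\<^esub> z = \<zero>\<^bsub>Z\<^esub>"
      if "y \<in> carrier Z" "z \<in> carrier Z" for y z
      using that Z.M.r_neg[of "y \<oplus>\<^bsub>Z\<^esub> z"] by (simp add: Z.M.minus_add Z.M.a_assoc)
    fix x assume x: "x \<in> relators"
    then have "ext x = \<zero>\<^bsub>Z\<^esub>"
      by (rule relators_cases)
        (use \<beta> in \<open>auto simp: ext e_closed BC.F_smult_closed BC.F_add_closed bilinear_map_def a_minus_def
          cancel Z.M.r_neg\<close>)
    with x relators_subset show "x \<in> ?ker"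
      by blast
  qed
  ultimately show ?thesis
    using N_minimal assms by blast
qed

lemma lift_coset:
  assumes f: "f \<in> carrier F"
  shows "lift (N +>\<^bsub>F\<^esub> f) = ext f"
proof -
  have "ext g = ext f" if "g \<in> N +>\<^bsub>F\<^esub> f" for g
  proof -
    obtain n where "n \<in> N" "g = n \<oplus>\<^bsub>F\<^esub> f"
      using \<open>g \<in> N +>\<^bsub>F\<^esub> f\<close> by (auto simp: a_r_coset_def')
    then show ?thesis
      using f N.a_Hcarr[of n] by (simp add: ext ext_relations)
  qed
  moreover have "f \<in> N +>\<^bsub>F\<^esub> f"
    by (rule N.a_rcos_self[OF f])
  ultimately have "ext ` (N +>\<^bsub>F\<^esub> f) = {ext f}"
    by blast
  then show ?thesis
    by (simp add: tensor_lift_def linear_extension_def)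
qed

lemma lift_pure: "\<lbrakk>b \<in> carrier B; c \<in> carrier C\<rbrakk> \<Longrightarrow> lift (b \<otimes>\<^sub>K c) = \<beta> b c"
  by (simp add: pure_tensor_def lift_coset e_closed ext)

lemma lift_closed: "x \<in> carrier BC \<Longrightarrow> lift x \<in> carrier Z"
  by (auto simp: carrier_tensor lift_coset ext)

lemma lift_add: "\<lbrakk>x \<in> carrier BC; y \<in> carrier BC\<rbrakk> \<Longrightarrow> lift (x \<oplus>\<^bsub>BC\<^esub> y) = lift x \<oplus>\<^bsub>Z\<^esub> lift y"
  by (auto simp: carrier_tensor coset_ops lift_coset ext)

lemma lift_smult: "\<lbrakk>k \<in> carrier K; x \<in> carrier BC\<rbrakk> \<Longrightarrow> lift (k \<odot>\<^bsub>BC\<^esub> x) = k \<odot>\<^bsub>Z\<^esub> lift x"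
  by (auto simp: carrier_tensor coset_ops lift_coset BC.F_smult_closed ext)

end

text \<open>
  Three bilinear maps are allowed here because rebracketing a triple tensor product lifts, for each
  fixed last component, a different map, and these maps are multiplicative only jointly.
\<close>

lemma lift_mult:
  assumes Z: "unital_algebra K Z"
    and \<beta>: "bilinear_map K B C Z \<beta>" and \<gamma>: "bilinear_map K B C Z \<gamma>" and \<delta>: "bilinear_map K B C Z \<delta>"
    and mult: "\<And>b c b' c'. \<lbrakk>b \<in> carrier B; c \<in> carrier C; b' \<in> carrier B; c' \<in> carrier C\<rbrakk> \<Longrightarrow>
      \<beta> b c \<otimes>\<^bsub>Z\<^esub> \<gamma> b' c' = \<delta> (b \<otimes>\<^bsub>B\<^esub> b') (c \<otimes>\<^bsub>C\<^esub> c')"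
    and x: "x \<in> carrier BC" and y: "y \<in> carrier BC"
  shows "tensor_lift K Z \<delta> (x \<otimes>\<^bsub>BC\<^esub> y) = tensor_lift K Z \<beta> x \<otimes>\<^bsub>Z\<^esub> tensor_lift K Z \<gamma> y"
proof -
  interpret Z: unital_algebra K Z by (rule Z)
  note lift = lift_closed[OF Z.module_axioms] lift_pure[OF Z.module_axioms] lift_add[OF Z.module_axioms]
  note lift = lift[OF \<beta>] lift[OF \<gamma>] lift[OF \<delta>]
  have \<beta>_closed: "\<beta> b c \<in> carrier Z" if "b \<in> carrier B" "c \<in> carrier C" for b c
    using \<beta> that by (simp add: bilinear_map_def)
  show ?thesis
    using x
  proof (induction rule: tensor_induct)
    case bc: (pure b c)
    show ?case
      using y
      by (induction rule: tensor_induct)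
        (use bc in \<open>simp_all add: tensor_closed tensor_mult lift mult T.B.r_distr Z.r_distr \<beta>_closed\<close>)
  qed (use y in \<open>simp_all add: lift T.B.l_distr Z.l_distr\<close>)
qed

text \<open>
  The universal property of the tensor product in the form used throughout: a bilinear map that is
  multiplicative on pairs induces a homomorphism of algebras.
\<close>

lemma lift_hom:
  assumes Z: "unital_algebra K Z" and \<beta>: "bilinear_map K B C Z \<beta>"
    and one: "\<beta> \<one>\<^bsub>B\<^esub> \<one>\<^bsub>C\<^esub> = \<one>\<^bsub>Z\<^esub>"
    and mult: "\<And>b c b' c'. \<lbrakk>b \<in> carrier B; c \<in> carrier C; b' \<in> carrier B; c' \<in> carrier C\<rbrakk> \<Longrightarrow>
      \<beta> b c \<otimes>\<^bsub>Z\<^esub> \<beta> b' c' = \<beta> (b \<otimes>\<^bsub>B\<^esub> b') (c \<otimes>\<^bsub>C\<^esub> c')"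
  shows "tensor_lift K Z \<beta> \<in> unital_algebra_hom K BC Z"
proof -
  interpret Z: unital_algebra K Z by (rule Z)
  note lift = lift_closed[OF Z.module_axioms \<beta>] lift_pure[OF Z.module_axioms \<beta>]
    lift_add[OF Z.module_axioms \<beta>] lift_smult[OF Z.module_axioms \<beta>]
    lift_mult[OF Z \<beta> \<beta> \<beta> mult]
  show ?thesis
    by (auto simp: unital_algebra_hom_def ring_hom_def lift tensor_one one)
qed

end


section \<open>Homomorphisms between tensor products\<close>

lemma unital_algebra_homD:
  assumes "h \<in> unital_algebra_hom K B C"
  shows "x \<in> carrier B \<Longrightarrow> h x \<in> carrier C"
    and "\<lbrakk>x \<in> carrier B; y \<in> carrier B\<rbrakk> \<Longrightarrow> h (x \<oplus>\<^bsub>B\<^esub> y) = h x \<oplus>\<^bsub>C\<^esub> h y"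
    and "\<lbrakk>x \<in> carrier B; y \<in> carrier B\<rbrakk> \<Longrightarrow> h (x \<otimes>\<^bsub>B\<^esub> y) = h x \<otimes>\<^bsub>C\<^esub> h y"
    and "\<lbrakk>k \<in> carrier K; x \<in> carrier B\<rbrakk> \<Longrightarrow> h (k \<odot>\<^bsub>B\<^esub> x) = k \<odot>\<^bsub>C\<^esub> h x"
    and "h \<one>\<^bsub>B\<^esub> = \<one>\<^bsub>C\<^esub>"
  using assms by (auto simp: unital_algebra_hom_def ring_hom_def)

lemma id_unital_algebra_hom: "(\<lambda>x. x) \<in> unital_algebra_hom K B B"
  by (auto simp: unital_algebra_hom_def ring_hom_def)

lemma unital_algebra_hom_comp:
  assumes "h \<in> unital_algebra_hom K B C" "g \<in> unital_algebra_hom K C D"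
  shows "(\<lambda>x. g (h x)) \<in> unital_algebra_hom K B D"
  using unital_algebra_homD[OF assms(1)] unital_algebra_homD[OF assms(2)]
  by (auto simp: unital_algebra_hom_def ring_hom_def)

context
  fixes K :: "('k, 'n) ring_scheme"
    and B :: "('k, 'b, 'm) module_scheme" and C :: "('k, 'c, 'p) module_scheme"
    and B' :: "('k, 'd, 'q) module_scheme" and C' :: "('k, 'e, 'r) module_scheme"
    and g :: "'b \<Rightarrow> 'd" and h :: "'c \<Rightarrow> 'e"
  assumes algebras: "unital_algebra K B" "unital_algebra K C" "unital_algebra K B'" "unital_algebra K C'"
    and g: "g \<in> unital_algebra_hom K B B'" and h: "h \<in> unital_algebra_hom K C C'"
begin

interpretation S: algebra_pair K B C
  by (intro algebra_pair.intro algebras)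

interpretation T: algebra_pair K B' C'
  by (intro algebra_pair.intro algebras)

lemma bilinear_tensor_map:
  "bilinear_map K B C (tensor_product K B' C') (\<lambda>b c. pure_tensor K B' C' (g b) (h c))"
  by (simp add: bilinear_map_def unital_algebra_homD[OF g] unital_algebra_homD[OF h] T.tensor_closed
      T.tensor_add_left T.tensor_add_right T.tensor_smult_left T.tensor_smult_right)

lemma tensor_map_hom:
  "tensor_map K B' C' g h \<in> unital_algebra_hom K (tensor_product K B C) (tensor_product K B' C')"
  unfolding tensor_map_def
  by (rule S.lift_hom[OF T.unital_algebra_tensor bilinear_tensor_map])
    (simp_all add: unital_algebra_homD[OF g] unital_algebra_homD[OF h] T.tensor_one T.tensor_mult)

lemma tensor_map_pure:
  "\<lbrakk>b \<in> carrier B; c \<in> carrier C\<rbrakk> \<Longrightarrow>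
    tensor_map K B' C' g h (pure_tensor K B C b c) = pure_tensor K B' C' (g b) (h c)"
  unfolding tensor_map_def
  by (rule S.lift_pure[OF T.T.module_axioms bilinear_tensor_map])

end

context
  fixes K :: "('k, 'n) ring_scheme" and B :: "('k, 'b, 'm) module_scheme"
    and C :: "('k, 'c, 'p) module_scheme" and D :: "('k, 'd, 'q) module_scheme"
  assumes algebras: "unital_algebra K B" "unital_algebra K C" "unital_algebra K D"
begin

interpretation BC: algebra_pair K B C
  by (intro algebra_pair.intro algebras)

interpretation CD: algebra_pair K C D
  by (intro algebra_pair.intro algebras)

interpretation L: algebra_pair K "tensor_product K B C" D
  by (intro algebra_pair.intro algebras BC.unital_algebra_tensor)

interpretation R: algebra_pair K B "tensor_product K C D"
  by (intro algebra_pair.intro algebras CD.unital_algebra_tensor)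

private abbreviation (input) "Z \<equiv> tensor_product K B (tensor_product K C D)"

text \<open>
  The inner bilinear map of \<open>tensor_assoc\<close>, with the last component \<open>d\<close> held fixed.  Its lift must be
  shown to depend linearly on \<open>d\<close> as well before the outer lift can be formed.
\<close>

private definition slice where
  "slice d b c = pure_tensor K B (tensor_product K C D) b (pure_tensor K C D c d)"

private lemma bilinear_slice: "d \<in> carrier D \<Longrightarrow> bilinear_map K B C Z (slice d)"
  by (simp add: bilinear_map_def slice_def R.tensor_closed CD.tensor_closed R.tensor_add_left
      R.tensor_add_right CD.tensor_add_left R.tensor_smult_left R.tensor_smult_right
      CD.tensor_smult_left)

private lemmas slice_lift = BC.lift_closed[OF R.T.module_axioms bilinear_slice]
  BC.lift_add[OF R.T.module_axioms bilinear_slice]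
  BC.lift_smult[OF R.T.module_axioms bilinear_slice]
  BC.lift_pure[OF R.T.module_axioms bilinear_slice]

private lemma slice_lift_add_right:
  assumes t: "t \<in> carrier (tensor_product K B C)" and d: "d \<in> carrier D" "d' \<in> carrier D"
  shows "tensor_lift K Z (slice (d \<oplus>\<^bsub>D\<^esub> d')) t
    = tensor_lift K Z (slice d) t \<oplus>\<^bsub>Z\<^esub> tensor_lift K Z (slice d') t"
  using t
proof (induction rule: BC.tensor_induct)
  case (pure b c)
  then show ?case
    using d by (simp add: slice_lift) (simp add: slice_def CD.tensor_add_right R.tensor_add_right CD.tensor_closed)
next
  case (add x y)
  then show ?case
    using d by (simp add: slice_lift R.T.M.a_ac)
qed

private lemma slice_lift_smult_right:
  assumes t: "t \<in> carrier (tensor_product K B C)" and k: "k \<in> carrier K" and d: "d \<in> carrier D"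
  shows "tensor_lift K Z (slice (k \<odot>\<^bsub>D\<^esub> d)) t = k \<odot>\<^bsub>Z\<^esub> tensor_lift K Z (slice d) t"
  using t
proof (induction rule: BC.tensor_induct)
  case (pure b c)
  then show ?case
    using k d by (simp add: slice_lift) (simp add: slice_def CD.tensor_smult_right R.tensor_smult_right CD.tensor_closed)
next
  case (add x y)
  then show ?case
    using k d by (simp add: slice_lift R.T.smult_r_distr)
qed

private lemma bilinear_assoc:
  "bilinear_map K (tensor_product K B C) D Z (\<lambda>t d. tensor_lift K Z (slice d) t)"
  by (simp add: bilinear_map_def slice_lift slice_lift_add_right slice_lift_smult_right)

private lemma tensor_assoc_eq:
  "tensor_assoc K B C D = tensor_lift K Z (\<lambda>t d. tensor_lift K Z (slice d) t)"
  by (simp add: tensor_assoc_def slice_def[abs_def] Let_def)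

text \<open>
  For fixed \<open>d\<close> the inner lift is in general not a homomorphism; what holds is that the lifts at
  \<open>d\<close> and \<open>d'\<close> multiply to the lift at \<open>d d'\<close>.
\<close>

lemma tensor_assoc_hom:
  "tensor_assoc K B C D \<in> unital_algebra_hom K (tensor_product K (tensor_product K B C) D) Z"
  unfolding tensor_assoc_eq
proof (rule L.lift_hom[OF R.unital_algebra_tensor bilinear_assoc])
  show "tensor_lift K Z (slice \<one>\<^bsub>D\<^esub>) \<one>\<^bsub>tensor_product K B C\<^esub> = \<one>\<^bsub>Z\<^esub>"
    unfolding BC.tensor_one by (simp add: slice_lift) (simp add: slice_def R.tensor_one CD.tensor_one)
next
  fix t d t' d'
  assume "t \<in> carrier (tensor_product K B C)" "d \<in> carrier D"
    "t' \<in> carrier (tensor_product K B C)" "d' \<in> carrier D"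
  then show "tensor_lift K Z (slice d) t \<otimes>\<^bsub>Z\<^esub> tensor_lift K Z (slice d') t' =
      tensor_lift K Z (slice (d \<otimes>\<^bsub>D\<^esub> d')) (t \<otimes>\<^bsub>tensor_product K B C\<^esub> t')"
    by (intro BC.lift_mult[symmetric] R.unital_algebra_tensor bilinear_slice)
      (simp_all add: slice_def R.tensor_mult CD.tensor_mult CD.tensor_closed)
qed

lemma tensor_assoc_pure:
  "\<lbrakk>b \<in> carrier B; c \<in> carrier C; d \<in> carrier D\<rbrakk> \<Longrightarrow>
    tensor_assoc K B C D (pure_tensor K (tensor_product K B C) D (pure_tensor K B C b c) d) =
      pure_tensor K B (tensor_product K C D) b (pure_tensor K C D c d)"
  unfolding tensor_assoc_eq
  by (simp add: L.lift_pure[OF R.T.module_axioms bilinear_assoc] BC.tensor_closed slice_lift)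
    (simp add: slice_def)

end


section \<open>Generators of the enveloping algebra\<close>

context right_symmetric_algebra
begin

abbreviation "V \<equiv> direct_sum A A"
abbreviation "W \<equiv> word_monoid (carrier V)"
abbreviation "F \<equiv> monoid_algebra K W"
abbreviation "I \<equiv> tensor_algebra_ideal K V"
abbreviation "T \<equiv> tensor_algebra K V"
abbreviation "E \<equiv> enveloping_ideal K A"
abbreviation "U \<equiv> enveloping_algebra K A"

lemma direct_sum_simps:
  "carrier V = carrier A \<times> carrier A"
  "(a, b) \<oplus>\<^bsub>V\<^esub> (a', b') = (a \<oplus>\<^bsub>A\<^esub> a', b \<oplus>\<^bsub>A\<^esub> b')"
  "k \<odot>\<^bsub>V\<^esub> (a, b) = (k \<odot>\<^bsub>A\<^esub> a, k \<odot>\<^bsub>A\<^esub> b)"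
  by (simp_all add: direct_sum_def)

lemma word_simps: "carrier W = lists (carrier V)" "u \<otimes>\<^bsub>W\<^esub> v = u @ v" "\<one>\<^bsub>W\<^esub> = []"
  by (simp_all add: word_monoid_def)

interpretation W: monoid_ring K W
  by (intro monoid_ring.intro K.is_cring monoidI) (auto simp: word_simps)

lemma letter_closed: "v \<in> carrier V \<Longrightarrow> monomial K [v] \<in> carrier F"
  by (rule W.monomial_closed) (simp add: word_simps)

definition tensor_algebra_relators where
  "tensor_algebra_relators =
    {monomial K [u \<oplus>\<^bsub>V\<^esub> v] \<ominus>\<^bsub>F\<^esub> monomial K [u] \<ominus>\<^bsub>F\<^esub> monomial K [v] | u v.
        u \<in> carrier V \<and> v \<in> carrier V}
     \<union> {monomial K [k \<odot>\<^bsub>V\<^esub> v] \<ominus>\<^bsub>F\<^esub> k \<odot>\<^bsub>F\<^esub> monomial K [v] | k v.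
        k \<in> carrier K \<and> v \<in> carrier V}"

lemma additive_relator:
  "\<lbrakk>u \<in> carrier V; v \<in> carrier V\<rbrakk> \<Longrightarrow>
    monomial K [u \<oplus>\<^bsub>V\<^esub> v] \<ominus>\<^bsub>F\<^esub> monomial K [u] \<ominus>\<^bsub>F\<^esub> monomial K [v] \<in> tensor_algebra_relators"
  unfolding tensor_algebra_relators_def by blast

lemma I_eq: "I = Idl\<^bsub>F\<^esub> tensor_algebra_relators"
  unfolding tensor_algebra_ideal_def tensor_algebra_relators_def Let_def ..

lemma V_closed:
  "\<lbrakk>u \<in> carrier V; v \<in> carrier V\<rbrakk> \<Longrightarrow> u \<oplus>\<^bsub>V\<^esub> v \<in> carrier V"
  "\<lbrakk>k \<in> carrier K; v \<in> carrier V\<rbrakk> \<Longrightarrow> k \<odot>\<^bsub>V\<^esub> v \<in> carrier V"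
  by (auto simp: direct_sum_simps)

lemma tensor_algebra_relators_closed: "tensor_algebra_relators \<subseteq> carrier F"
  unfolding tensor_algebra_relators_def
  by (intro subsetI; elim UnE CollectE exE conjE)
    (simp_all add: letter_closed V_closed W.F_smult_closed W.F.M.minus_closed)

lemma I_ideal: "ideal I F"
  unfolding I_eq by (rule W.F.B.genideal_ideal[OF tensor_algebra_relators_closed])

interpretation I: ideal I F by (rule I_ideal)

lemma unital_algebra_T: "unital_algebra K T"
  unfolding tensor_algebra_def by (rule W.F.unital_algebra_quotient[OF I_ideal])

interpretation T: unital_algebra K T by (rule unital_algebra_T)

lemma carrier_T: "carrier T = (+>\<^bsub>F\<^esub>) I ` carrier F"
  unfolding tensor_algebra_def by (rule W.F.carrier_quotient[OF I_ideal])

lemma T_hom: "(+>\<^bsub>F\<^esub>) I \<in> unital_algebra_hom K F T"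
  unfolding tensor_algebra_def by (rule W.F.quotient_hom[OF I_ideal])

lemma pair_letter_closed: "\<lbrakk>a \<in> carrier A; b \<in> carrier A\<rbrakk> \<Longrightarrow> monomial K [(a, b)] \<in> carrier F"
  by (rule letter_closed) (simp add: direct_sum_simps)

lemma tensor_r_closed: "a \<in> carrier A \<Longrightarrow> tensor_r K A a \<in> carrier T"
  and tensor_l_closed: "a \<in> carrier A \<Longrightarrow> tensor_l K A a \<in> carrier T"
  by (simp_all add: carrier_T tensor_r_def tensor_l_def tensor_algebra_inj_def pair_letter_closed)

definition enveloping_relators where
  "enveloping_relators =
    {tensor_r K A (commutator A a b) \<ominus>\<^bsub>T\<^esub> tensor_r K A a \<otimes>\<^bsub>T\<^esub> tensor_r K A b
        \<oplus>\<^bsub>T\<^esub> tensor_r K A b \<otimes>\<^bsub>T\<^esub> tensor_r K A a | a b. a \<in> carrier A \<and> b \<in> carrier A}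
     \<union> {commutator T (tensor_r K A b) (tensor_l K A a) \<ominus>\<^bsub>T\<^esub> tensor_l K A b \<otimes>\<^bsub>T\<^esub> tensor_l K A a
        \<oplus>\<^bsub>T\<^esub> tensor_l K A (a \<otimes>\<^bsub>A\<^esub> b) | a b. a \<in> carrier A \<and> b \<in> carrier A}"

lemma E_eq: "E = Idl\<^bsub>T\<^esub> enveloping_relators"
  unfolding enveloping_ideal_def enveloping_relators_def Let_def ..

lemma enveloping_relators_closed: "enveloping_relators \<subseteq> carrier T"
  unfolding enveloping_relators_def
  by (intro subsetI; elim UnE CollectE exE conjE)
    (simp_all add: commutator_def tensor_r_closed tensor_l_closed prod_closed)

lemma E_ideal: "ideal E T"
  unfolding E_eq by (rule T.B.genideal_ideal[OF enveloping_relators_closed])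

lemma unital_algebra_U: "unital_algebra K U"
  unfolding enveloping_algebra_def by (rule T.unital_algebra_quotient[OF E_ideal])

interpretation U: unital_algebra K U by (rule unital_algebra_U)

lemma carrier_U: "carrier U = (+>\<^bsub>T\<^esub>) E ` carrier T"
  unfolding enveloping_algebra_def by (rule T.carrier_quotient[OF E_ideal])

lemma U_hom: "(+>\<^bsub>T\<^esub>) E \<in> unital_algebra_hom K T U"
  unfolding enveloping_algebra_def by (rule T.quotient_hom[OF E_ideal])

lemma env_r_closed: "a \<in> carrier A \<Longrightarrow> env_r K A a \<in> carrier U"
  and env_l_closed: "a \<in> carrier A \<Longrightarrow> env_l K A a \<in> carrier U"
  by (simp_all add: carrier_U env_r_def env_l_def tensor_r_closed tensor_l_closed)

text \<open>
  The composite of the two projections from the free algebra on the set \<open>A\<^sup>r \<oplus> A\<^sup>l\<close> through the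
  tensor algebra onto \<open>U(A)\<close>.  It reduces statements about \<open>U(A)\<close> to words.
\<close>

definition word_class where
  "word_class f = E +>\<^bsub>T\<^esub> (I +>\<^bsub>F\<^esub> f)"

lemma word_class_hom: "word_class \<in> unital_algebra_hom K F U"
  using unital_algebra_hom_comp[OF T_hom U_hom] by (simp add: word_class_def[abs_def])

lemma carrier_U_words: "carrier U = word_class ` carrier F"
  by (auto simp: carrier_U carrier_T word_class_def)

text \<open>
  The free algebra has one letter for every vector of \<open>A\<^sup>r \<oplus> A\<^sup>l\<close>, not only for the vectors \<open>r\<^sub>a\<close> and
  \<open>l\<^sub>b\<close>.  Additivity of \<open>V \<rightarrow> T(V)\<close> splits a general letter, because \<open>(a, b) = (a, 0) + (0, b)\<close>.
\<close>

lemma word_class_letter: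
  assumes a: "a \<in> carrier A" and b: "b \<in> carrier A"
  shows "word_class (monomial K [(a, b)]) = env_r K A a \<oplus>\<^bsub>U\<^esub> env_l K A b"
proof -
  let ?x = "monomial K [(a, b)]" and ?y = "monomial K [(a, \<zero>\<^bsub>A\<^esub>)]" and ?z = "monomial K [(\<zero>\<^bsub>A\<^esub>, b)]"
  have closed: "?x \<in> carrier F" "?y \<in> carrier F" "?z \<in> carrier F"
    using a b by (simp_all add: pair_letter_closed)
  have "?x \<ominus>\<^bsub>F\<^esub> ?y \<ominus>\<^bsub>F\<^esub> ?z \<in> tensor_algebra_relators"
    using additive_relator[of "(a, \<zero>\<^bsub>A\<^esub>)" "(\<zero>\<^bsub>A\<^esub>, b)"] a b by (simp add: direct_sum_simps)
  then have "?x \<ominus>\<^bsub>F\<^esub> ?y \<ominus>\<^bsub>F\<^esub> ?z \<in> I"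
    unfolding I_eq using W.F.B.genideal_self[OF tensor_algebra_relators_closed] by blast
  moreover have "?x \<ominus>\<^bsub>F\<^esub> ?y \<ominus>\<^bsub>F\<^esub> ?z = ?x \<ominus>\<^bsub>F\<^esub> (?y \<oplus>\<^bsub>F\<^esub> ?z)"
    using closed by (simp add: a_minus_def W.F.M.minus_add W.F.M.a_assoc)
  ultimately have "I +>\<^bsub>F\<^esub> ?x = I +>\<^bsub>F\<^esub> (?y \<oplus>\<^bsub>F\<^esub> ?z)"
    using closed by (metis I.a_repr_independence' I.a_rcos_module_minus W.F.B.ring_axioms W.F_add_closed)
  then have "word_class ?x = word_class (?y \<oplus>\<^bsub>F\<^esub> ?z)"
    by (simp add: word_class_def)
  also have "\<dots> = word_class ?y \<oplus>\<^bsub>U\<^esub> word_class ?z"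
    using closed by (simp add: unital_algebra_homD[OF word_class_hom])
  finally show ?thesis
    by (simp add: word_class_def env_r_def env_l_def tensor_r_def tensor_l_def tensor_algebra_inj_def)
qed

text \<open>
  Every element is the class of a linear combination of words, a word is a product of letters, and
  the class of a letter is a sum \<open>r\<^sub>a + l\<^sub>b\<close>.
\<close>

lemma U_induct [consumes 1, case_names one r l add mult smult]:
  assumes "u \<in> carrier U"
    and one: "P \<one>\<^bsub>U\<^esub>"
    and r: "\<And>a. a \<in> carrier A \<Longrightarrow> P (env_r K A a)"
    and l: "\<And>a. a \<in> carrier A \<Longrightarrow> P (env_l K A a)"
    and add: "\<And>x y. \<lbrakk>x \<in> carrier U; y \<in> carrier U; P x; P y\<rbrakk> \<Longrightarrow> P (x \<oplus>\<^bsub>U\<^esub> y)"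
    and mult: "\<And>x y. \<lbrakk>x \<in> carrier U; y \<in> carrier U; P x; P y\<rbrakk> \<Longrightarrow> P (x \<otimes>\<^bsub>U\<^esub> y)"
    and smult: "\<And>k x. \<lbrakk>k \<in> carrier K; x \<in> carrier U; P x\<rbrakk> \<Longrightarrow> P (k \<odot>\<^bsub>U\<^esub> x)"
  shows "P u"
proof -
  note q = unital_algebra_homD[OF word_class_hom]
  have word: "P (word_class (monomial K w))" if "w \<in> carrier W" for w
    using that
  proof (induction w)
    case Nil
    then show ?case
      using one q(5) by (simp add: W.F_one word_simps)
  next
    case (Cons v w)
    have "v \<in> carrier V"
      using Cons.prems by (simp add: word_simps)
    then obtain a b where v: "v = (a, b)" "a \<in> carrier A" "b \<in> carrier A"
      by (auto simp: direct_sum_simps)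
    have closed: "[v] \<in> carrier W" "w \<in> carrier W"
      using Cons.prems by (auto simp: word_simps)
    then have "word_class (monomial K (v # w)) =
        word_class (monomial K [v]) \<otimes>\<^bsub>U\<^esub> word_class (monomial K w)"
      using W.F_mult_basis[OF closed] by (simp add: q(3)[symmetric] W.monomial_closed word_simps)
    moreover have "P (word_class (monomial K [v]))"
      using v by (simp add: word_class_letter add r l env_r_closed env_l_closed)
    ultimately show ?case
      using Cons.IH closed mult q(1) W.monomial_closed by simp
  qed
  obtain f where f: "f \<in> carrier F" "u = word_class f"
    using assms(1) by (auto simp: carrier_U_words)
  have "P (word_class f)"
    using f(1)
  proof (induction rule: W.F_induct)
    case zero
    have "word_class \<zero>\<^bsub>F\<^esub> = \<zero>\<^bsub>K\<^esub> \<odot>\<^bsub>U\<^esub> \<one>\<^bsub>U\<^esub>"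
      using q(4)[of "\<zero>\<^bsub>K\<^esub>" "\<one>\<^bsub>F\<^esub>"] by (simp add: q(5))
    then show ?case
      using smult[of "\<zero>\<^bsub>K\<^esub>" "\<one>\<^bsub>U\<^esub>"] one by simp
  next
    case (basis k w)
    then show ?case
      by (simp add: q smult word W.monomial_closed)
  next
    case (add f g)
    then show ?case
      by (simp add: q assms(5))
  qed
  with f(2) show ?thesis
    by simp
qed

lemma U_hom_eqI:
  assumes \<phi>: "\<phi> \<in> unital_algebra_hom K U X" and \<psi>: "\<psi> \<in> unital_algebra_hom K U X"
    and "\<And>a. a \<in> carrier A \<Longrightarrow> \<phi> (env_r K A a) = \<psi> (env_r K A a)"
    and "\<And>a. a \<in> carrier A \<Longrightarrow> \<phi> (env_l K A a) = \<psi> (env_l K A a)"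
    and "u \<in> carrier U"
  shows "\<phi> u = \<psi> u"
  using assms(5)
  by (induction rule: U_induct)
    (simp_all add: assms(3,4) unital_algebra_homD[OF \<phi>] unital_algebra_homD[OF \<psi>])

end

section \<open>Coassociativity\<close>

theorem theorem2p3:
  fixes K :: "('k, 'n) ring_scheme"
    and A :: "('k, 'a, 'm) module_scheme"
    and U :: "('k, (('a \<times> 'a) list \<Rightarrow> 'k) set set) module"
    and \<Delta> :: "(('a \<times> 'a) list \<Rightarrow> 'k) set set
      \<Rightarrow> ((('a \<times> 'a) list \<Rightarrow> 'k) set set \<times> (('a \<times> 'a) list \<Rightarrow> 'k) set set \<Rightarrow> 'k) set"
  assumes "right_symmetric_algebra K A"
    and "U = enveloping_algebra K A"
    and "\<Delta> \<in> unital_algebra_hom K U (tensor_product K U U)"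
    and "\<Delta> \<one>\<^bsub>U\<^esub> = pure_tensor K U U \<one>\<^bsub>U\<^esub> \<one>\<^bsub>U\<^esub>"
    and "\<And>a. a \<in> carrier A \<Longrightarrow>
      \<Delta> (env_r K A a) = pure_tensor K U U (env_r K A a) \<one>\<^bsub>U\<^esub>
        \<oplus>\<^bsub>tensor_product K U U\<^esub> pure_tensor K U U \<one>\<^bsub>U\<^esub> (env_r K A a \<ominus>\<^bsub>U\<^esub> env_l K A a)"
    and "\<And>a. a \<in> carrier A \<Longrightarrow>
      \<Delta> (env_l K A a) = pure_tensor K U U (env_l K A a) \<one>\<^bsub>U\<^esub>"
  shows "\<forall>u\<in>carrier U.
    tensor_map K U (tensor_product K U U) (\<lambda>x. x) \<Delta> (\<Delta> u)
      = tensor_assoc K U U U (tensor_map K (tensor_product K U U) U \<Delta> (\<lambda>x. x) (\<Delta> u))"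
proof
  fix u assume u: "u \<in> carrier U"
  interpret A: right_symmetric_algebra K A by fact
  have U: "unital_algebra K U"
    unfolding assms(2) by (rule A.unital_algebra_U)
  interpret U: unital_algebra K U by (rule U)
  interpret UU: algebra_pair K U U
    by (intro algebra_pair.intro U)
  let ?T = "tensor_product K U U"
  let ?r = "env_r K A" and ?l = "env_l K A"
  have T: "unital_algebra K ?T"
    by (rule UU.unital_algebra_tensor)
  interpret UT: algebra_pair K U ?T
    by (intro algebra_pair.intro U T)
  interpret TU: algebra_pair K ?T U
    by (intro algebra_pair.intro U T)
  note \<Delta> = assms(3)
  note id = id_unital_algebra_hom[of K U]
  let ?id\<Delta> = "tensor_map K U ?T (\<lambda>x. x) \<Delta>" and ?\<Delta>id = "tensor_map K ?T U \<Delta> (\<lambda>x. x)"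
  let ?assoc = "tensor_assoc K U U U"
  have id\<Delta>: "?id\<Delta> \<in> unital_algebra_hom K ?T (tensor_product K U ?T)"
    by (rule tensor_map_hom[OF U U U T id \<Delta>])
  have \<Delta>id: "?\<Delta>id \<in> unital_algebra_hom K ?T (tensor_product K ?T U)"
    by (rule tensor_map_hom[OF U U T U \<Delta> id])
  have assoc: "?assoc \<in> unital_algebra_hom K (tensor_product K ?T U) (tensor_product K U ?T)"
    by (rule tensor_assoc_hom[OF U U U])
  note pure = tensor_map_pure[OF U U U T id \<Delta>] tensor_map_pure[OF U U T U \<Delta> id]
    tensor_assoc_pure[OF U U U]
  note hom = unital_algebra_homD[OF id\<Delta>] unital_algebra_homD[OF \<Delta>id] unital_algebra_homD[OF assoc]
    unital_algebra_homD[OF \<Delta>]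
  have gen_closed: "?r a \<in> carrier U" "?l a \<in> carrier U" if "a \<in> carrier A" for a
    using A.env_r_closed[OF that] A.env_l_closed[OF that] by (simp_all add: assms(2))
  note closed = gen_closed UU.tensor_closed UT.tensor_closed TU.tensor_closed
  show "?id\<Delta> (\<Delta> u) = ?assoc (?\<Delta>id (\<Delta> u))"
  proof (rule A.U_hom_eqI[of _ "tensor_product K U ?T"])
    show "u \<in> carrier (enveloping_algebra K A)"
      using u by (simp add: assms(2))
    show "(\<lambda>u. ?id\<Delta> (\<Delta> u)) \<in> unital_algebra_hom K (enveloping_algebra K A) (tensor_product K U ?T)"
      using unital_algebra_hom_comp[OF \<Delta> id\<Delta>] by (simp add: assms(2))
    show "(\<lambda>u. ?assoc (?\<Delta>id (\<Delta> u))) \<in>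
        unital_algebra_hom K (enveloping_algebra K A) (tensor_product K U ?T)"
      using unital_algebra_hom_comp[OF unital_algebra_hom_comp[OF \<Delta> \<Delta>id] assoc]
      by (simp add: assms(2))
    fix a assume a: "a \<in> carrier A"
    show "?id\<Delta> (\<Delta> (?l a)) = ?assoc (?\<Delta>id (\<Delta> (?l a)))"
      using a by (simp add: assms(4,6) pure closed)
    (* The image of 1 \<otimes> (r_a - l_a) under 1 \<otimes> \<Delta> involves \<Delta> (r_a - l_a), so s is shown to be primitive. *)
    define s where "s = ?r a \<ominus>\<^bsub>U\<^esub> ?l a"
    have s: "s \<in> carrier U" and r: "?r a = s \<oplus>\<^bsub>U\<^esub> ?l a"
      using a by (simp_all add: s_def closed a_minus_def U.M.a_assoc U.M.l_neg)
    have \<Delta>r: "\<Delta> (?r a) = pure_tensor K U U (?r a) \<one>\<^bsub>U\<^esub> \<oplus>\<^bsub>?T\<^esub> pure_tensor K U U \<one>\<^bsub>U\<^esub> s"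
      using assms(5)[OF a] by (simp add: s_def)
    (* Write r_a = s + l_a on both sides of the formula for r_a; the term from l_a cancels. *)
    have "\<Delta> s \<oplus>\<^bsub>?T\<^esub> pure_tensor K U U (?l a) \<one>\<^bsub>U\<^esub> =
        (pure_tensor K U U s \<one>\<^bsub>U\<^esub> \<oplus>\<^bsub>?T\<^esub> pure_tensor K U U \<one>\<^bsub>U\<^esub> s) \<oplus>\<^bsub>?T\<^esub> pure_tensor K U U (?l a) \<one>\<^bsub>U\<^esub>"
      using \<Delta>r a s by (simp add: r hom assms(6) closed UU.tensor_add_left UU.T.M.a_ac)
    then have \<Delta>s: "\<Delta> s = pure_tensor K U U s \<one>\<^bsub>U\<^esub> \<oplus>\<^bsub>?T\<^esub> pure_tensor K U U \<one>\<^bsub>U\<^esub> s"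
      using a s by (simp add: hom closed)
    show "?id\<Delta> (\<Delta> (?r a)) = ?assoc (?\<Delta>id (\<Delta> (?r a)))"
      using a s
      by (simp add: \<Delta>r \<Delta>s assms(4) hom pure closed UT.tensor_add_right TU.tensor_add_left UT.T.M.a_assoc)
  qed
qed

end
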